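(* Let $X\subseteq\mathbb{R}^p$, $U\subseteq\mathbb{R}^q$ be open, $n\ge1$, and let $\mathcal{S}_\Delta\subseteq J^n$ be an $n$-th order system of PDEs. Let $L$ be a rectifiable PDE Lie algebra of vector fields on $X\times U$ and let $L'$ be an associated rectified PDE Lie algebra, and assume $\mathcal{S}^n_L$ and $\mathcal{S}_\Delta$ are non-vacuously transversal. Then $L$ is a Lie algebra of conditional symmetries of $\mathcal{S}_\Delta$ if and only if $L'$ is a Lie algebra of conditional symmetries of $\mathcal{S}_\Delta$.
   Context: Setting: $J^0=X\times U$, $\pi^0_{-1}:X\times U\to X$, $J^n$ the $n$-th jet bundle of $\pi^0_{-1}$, coordinates $(x^i,u^\alpha,u^\alpha_K)$, total derivatives $D_K$; $\mathbf{j}^nY$ is the prolongation of a vector field $Y$ on $X\times U$ to $J^n$. $\mathcal{S}_\Delta=\{P\in J^n:\Delta^\mu(P)=0,\ \mu=1,\dots,s\}$ for smooth $\Delta^\mu$ of maximal rank (so $\mathcal{S}_\Delta$ is a submanifold). For $Y=\sum_i\xi^i\partial_{x^i}+\sum_\alpha\varphi^\alpha\partial_{u^\alpha}$ the characteristics are $Q^\alpha_Y=\varphi^\alpha-\sum_i\xi^iu^\alpha_i$; the characteristic system $\mathcal{S}^n_L$ of a finite-dimensional linear space $L$ of vector fields is the common zero set of all $D_KQ^\alpha_Y$, $|K|\le n-1$, $Y\in L$ (intrinsically: where $\iota_{\mathbf{j}^nY}\theta=0$ for all $Y\in L$ and contact forms $\theta$). A rectified PDE Lie algebra is a $p$-dimensional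 Abelian Lie algebra of $\pi^0_{-1}$-projectable vector fields whose projections span $T_xX$ at every $x$. A rectifiable PDE Lie algebra is a Lie algebra $L$ of vector fields for which there is a rectified PDE Lie algebra $L'$ (an associated rectified PDE Lie algebra) with $\mathcal{S}^n_L=\mathcal{S}^n_{L'}$. $\mathcal{S}^n_L$ and $\mathcal{S}_\Delta$ are non-vacuously transversal if $\mathcal{S}^n_L\cap\mathcal{S}_\Delta\ne\emptyset$ and $T_P\mathcal{S}^n_L+T_P\mathcal{S}_\Delta=T_PJ^n$ at every $P$ in the intersection. A Lie algebra $L$ of vector fields on $X\times U$ is a Lie algebra of conditional symmetries of $\mathcal{S}_\Delta$ if $\mathbf{j}^nZ$ is tangent to $\mathcal{S}_\Delta\cap\mathcal{S}^n_L$ for every $Z\in L$. *)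

theory Defs
  imports "HOL-Analysis.Analysis" "HOL-Library.Multiset"
begin

fun Ck :: "nat \<Rightarrow> 'a::euclidean_space set \<Rightarrow> ('a \<Rightarrow> 'b::real_normed_vector) \<Rightarrow> bool" where
  "Ck 0 S f = continuous_on S f"
| "Ck (Suc k) S f = (\<exists>f'. (\<forall>x\<in>S. (f has_derivative f' x) (at x)) \<and> (\<forall>v. Ck k S (\<lambda>x. f' x v)))"

definition smooth_on :: "'a::euclidean_space set \<Rightarrow> ('a \<Rightarrow> 'b::real_normed_vector) \<Rightarrow> bool" where
  "smooth_on S f = (\<forall>k. Ck k S f)"

type_synonym ('p,'q) vfield = "(real^'p) \<times> (real^'q) \<Rightarrow> (real^'p) \<times> (real^'q)"

text \<open>A (smooth) vector field on the open set X \<times> U; it is normalised to be zero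
  outside X \<times> U so that vector fields are determined by their values on X \<times> U.\<close>
definition is_vfield :: "(real^'p::finite) set \<Rightarrow> (real^'q::finite) set \<Rightarrow> ('p,'q) vfield \<Rightarrow> bool" where
  "is_vfield X U Y = (smooth_on (X \<times> U) Y \<and> (\<forall>z. z \<notin> X \<times> U \<longrightarrow> Y z = 0))"

definition vf_bracket :: "(real^'p::finite) set \<Rightarrow> (real^'q::finite) set \<Rightarrow> ('p,'q) vfield \<Rightarrow> ('p,'q) vfield \<Rightarrow> ('p,'q) vfield" where
  "vf_bracket X U Y Z = (\<lambda>z. if z \<in> X \<times> U
      then frechet_derivative Z (at z) (Y z) - frechet_derivative Y (at z) (Z z) else 0)"

definition vf_subspace :: "('p::finite,'q::finite) vfield set \<Rightarrow> bool" where
  "vf_subspace L = ((\<lambda>z. 0) \<in> L \<and> (\<forall>Y\<in>L. \<forall>Z\<in>L. (\<lambda>z. Y z + Z z) \<in> L)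
       \<and> (\<forall>c. \<forall>Y\<in>L. (\<lambda>z. c *\<^sub>R Y z) \<in> L))"

definition vf_spans :: "('p,'q) vfield set \<Rightarrow> ('p::finite,'q::finite) vfield set \<Rightarrow> bool" where
  "vf_spans B L = (\<forall>Y\<in>L. \<exists>c. Y = (\<lambda>z. \<Sum>b\<in>B. c b *\<^sub>R b z))"

definition vf_independent :: "('p::finite,'q::finite) vfield set \<Rightarrow> bool" where
  "vf_independent B = (\<forall>c. (\<forall>z. (\<Sum>b\<in>B. c b *\<^sub>R b z) = 0) \<longrightarrow> (\<forall>b\<in>B. c b = 0))"

definition vf_finite_dim :: "('p::finite,'q::finite) vfield set \<Rightarrow> bool" where
  "vf_finite_dim L = (\<exists>B. finite B \<and> B \<subseteq> L \<and> vf_spans B L)"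

definition vf_dim_eq :: "('p::finite,'q::finite) vfield set \<Rightarrow> nat \<Rightarrow> bool" where
  "vf_dim_eq L d = (\<exists>B. finite B \<and> B \<subseteq> L \<and> vf_spans B L \<and> vf_independent B \<and> card B = d)"

definition vf_lie_algebra :: "(real^'p) set \<Rightarrow> (real^'q) set \<Rightarrow> ('p::finite,'q::finite) vfield set \<Rightarrow> bool" where
  "vf_lie_algebra X U L = ((\<forall>Y\<in>L. is_vfield X U Y) \<and> vf_subspace L \<and> vf_finite_dim L
      \<and> (\<forall>Y\<in>L. \<forall>Z\<in>L. vf_bracket X U Y Z \<in> L))"

definition projectable :: "(real^'p::finite) set \<Rightarrow> (real^'q::finite) set \<Rightarrow> ('p,'q) vfield \<Rightarrow> bool" where
  "projectable X U Y = (\<forall>x\<in>X. \<forall>u\<in>U. \<forall>u'\<in>U. fst (Y (x,u)) = fst (Y (x,u')))"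

definition rectified_pde_lie_algebra :: "(real^'p) set \<Rightarrow> (real^'q) set \<Rightarrow> ('p::finite,'q::finite) vfield set \<Rightarrow> bool" where
  "rectified_pde_lie_algebra X U L = (vf_lie_algebra X U L \<and> vf_dim_eq L CARD('p)
      \<and> (\<forall>Y\<in>L. \<forall>Z\<in>L. \<forall>z\<in>X \<times> U. vf_bracket X U Y Z z = 0)
      \<and> (\<forall>Y\<in>L. projectable X U Y)
      \<and> (\<forall>x\<in>X. \<forall>u\<in>U. span ((\<lambda>Y. fst (Y (x,u))) ` L) = UNIV))"

text \<open>Coordinate labels: x^i, and u^\<alpha>_K (K a multi-index = multiset of x-indices;
  u^\<alpha> = u^\<alpha>_{}).\<close>
datatype ('p,'q) jlab = JX 'p | JU 'q "'p multiset"

definition jlabs :: "nat \<Rightarrow> ('p,'q) jlab set" where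
  "jlabs n = range JX \<union> {JU a K | a K. size K \<le> n}"

text \<open>Points of J^n are vectors in real^'c, where lbl :: 'c \<Rightarrow> jlab is a bijection
  onto the labels of order \<le> n (a global coordinate chart).\<close>
definition crd :: "('c \<Rightarrow> ('p,'q) jlab) \<Rightarrow> ('p,'q) jlab \<Rightarrow> real^'c \<Rightarrow> real" where
  "crd lbl l P = P $ (inv lbl l)"

definition xpt :: "('c \<Rightarrow> ('p,'q) jlab) \<Rightarrow> real^'c \<Rightarrow> real^'p" where
  "xpt lbl P = (\<chi> i. crd lbl (JX i) P)"

definition upt :: "('c \<Rightarrow> ('p::finite,'q) jlab) \<Rightarrow> real^'c \<Rightarrow> real^'q" where
  "upt lbl P = (\<chi> a. crd lbl (JU a {#}) P)"

definition base :: "('c \<Rightarrow> ('p::finite,'q::finite) jlab) \<Rightarrow> real^'c \<Rightarrow> (real^'p) \<times> (real^'q)" where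
  "base lbl P = (xpt lbl P, upt lbl P)"

definition jet_space :: "('c \<Rightarrow> ('p::finite,'q::finite) jlab) \<Rightarrow> (real^'p) set \<Rightarrow> (real^'q) set \<Rightarrow> (real^'c) set" where
  "jet_space lbl X U = {P. base lbl P \<in> X \<times> U}"

definition pd :: "('c \<Rightarrow> ('p,'q) jlab) \<Rightarrow> ('p,'q) jlab \<Rightarrow> (real^'c \<Rightarrow> real) \<Rightarrow> real^'c \<Rightarrow> real" where
  "pd lbl l f P = frechet_derivative f (at P) (axis (inv lbl l) 1)"

text \<open>Total derivative D_i on J^n, for functions of order < n:
  D_i f = f_{x^i} + sum_{\<alpha>, |K| < n} u^\<alpha>_{K+i} f_{u^\<alpha>_K}.\<close>
definition tderiv :: "nat \<Rightarrow> ('c \<Rightarrow> ('p::finite,'q::finite) jlab) \<Rightarrow> 'p \<Rightarrow> (real^'c \<Rightarrow> real) \<Rightarrow> real^'c \<Rightarrow> real" where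
  "tderiv n lbl i f P = pd lbl (JX i) f P
     + (\<Sum>(a,K)\<in>UNIV \<times> {K. size K < n}. crd lbl (JU a (K + {#i#})) P * pd lbl (JU a K) f P)"

definition tderivs :: "nat \<Rightarrow> ('c \<Rightarrow> ('p::finite,'q::finite) jlab) \<Rightarrow> 'p list \<Rightarrow> (real^'c \<Rightarrow> real) \<Rightarrow> real^'c \<Rightarrow> real" where
  "tderivs n lbl is f = foldr (tderiv n lbl) is f"

definition charQ :: "('c \<Rightarrow> ('p::finite,'q::finite) jlab) \<Rightarrow> ('p,'q) vfield \<Rightarrow> 'q \<Rightarrow> real^'c \<Rightarrow> real" where
  "charQ lbl Y a P = snd (Y (base lbl P)) $ a
      - (\<Sum>i\<in>UNIV. fst (Y (base lbl P)) $ i * crd lbl (JU a {#i#}) P)"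

definition char_system :: "nat \<Rightarrow> ('c \<Rightarrow> ('p::finite,'q::finite) jlab) \<Rightarrow> (real^'p) set \<Rightarrow> (real^'q) set
     \<Rightarrow> ('p,'q) vfield set \<Rightarrow> (real^'c) set" where
  "char_system n lbl X U L = {P \<in> jet_space lbl X U.
      \<forall>Y\<in>L. \<forall>a. \<forall>is. length is \<le> n - 1 \<longrightarrow> tderivs n lbl is (charQ lbl Y a) P = 0}"

fun prol_u :: "nat \<Rightarrow> ('c \<Rightarrow> ('p::finite,'q::finite) jlab) \<Rightarrow> ('p,'q) vfield \<Rightarrow> 'q \<Rightarrow> 'p list \<Rightarrow> real^'c \<Rightarrow> real" where
  "prol_u n lbl Y a [] = (\<lambda>P. snd (Y (base lbl P)) $ a)"
| "prol_u n lbl Y a (j # js) = (\<lambda>P. tderiv n lbl j (prol_u n lbl Y a js) P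
      - (\<Sum>i\<in>UNIV. tderiv n lbl j (\<lambda>Q. fst (Y (base lbl Q)) $ i) P * crd lbl (JU a (mset js + {#i#})) P))"

definition prolong :: "nat \<Rightarrow> ('c \<Rightarrow> ('p::{finite,linorder},'q::finite) jlab) \<Rightarrow> ('p,'q) vfield \<Rightarrow> real^'c \<Rightarrow> real^'c" where
  "prolong n lbl Y P = (\<chi> c. case lbl c of
       JX i \<Rightarrow> fst (Y (base lbl P)) $ i
     | JU a K \<Rightarrow> prol_u n lbl Y a (sorted_list_of_multiset K) P)"

definition tangent_set :: "'a::real_normed_vector set \<Rightarrow> 'a \<Rightarrow> 'a set" where
  "tangent_set M P = {v. \<exists>\<gamma> e. e > 0 \<and> \<gamma> 0 = P \<and> (\<gamma> has_vector_derivative v) (at 0)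
       \<and> (\<forall>t. \<bar>t\<bar> < e \<longrightarrow> \<gamma> t \<in> M)}"

definition tangent_to :: "('a::real_normed_vector \<Rightarrow> 'a) \<Rightarrow> 'a set \<Rightarrow> bool" where
  "tangent_to V M = (\<forall>P\<in>M. V P \<in> tangent_set M P)"

definition pde_system :: "('c \<Rightarrow> ('p::finite,'q::finite) jlab) \<Rightarrow> (real^'p) set \<Rightarrow> (real^'q) set
     \<Rightarrow> nat \<Rightarrow> (nat \<Rightarrow> real^'c \<Rightarrow> real) \<Rightarrow> (real^'c) set" where
  "pde_system lbl X U s \<Delta> = {P \<in> jet_space lbl X U. \<forall>\<mu><s. \<Delta> \<mu> P = 0}"

definition maximal_rank_system :: "('c \<Rightarrow> ('p::finite,'q::finite) jlab) \<Rightarrow> (real^'p) set \<Rightarrow> (real^'q) set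
     \<Rightarrow> nat \<Rightarrow> (nat \<Rightarrow> real^'c \<Rightarrow> real) \<Rightarrow> bool" where
  "maximal_rank_system lbl X U s \<Delta> =
     ((\<forall>\<mu><s. smooth_on (jet_space lbl X U) (\<Delta> \<mu>))
      \<and> (\<forall>P\<in>pde_system lbl X U s \<Delta>. \<forall>c::nat\<Rightarrow>real.
           (\<forall>w. (\<Sum>\<mu><s. c \<mu> * frechet_derivative (\<Delta> \<mu>) (at P) w) = 0) \<longrightarrow> (\<forall>\<mu><s. c \<mu> = 0)))"

definition nonvacuously_transversal :: "'a::real_normed_vector set \<Rightarrow> 'a set \<Rightarrow> bool" where
  "nonvacuously_transversal A B = (A \<inter> B \<noteq> {} \<and>
     (\<forall>P\<in>A \<inter> B. {a + b | a b. a \<in> tangent_set A P \<and> b \<in> tangent_set B P} = UNIV))"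

definition conditional_symmetries :: "nat \<Rightarrow> ('c \<Rightarrow> ('p,'q) jlab) \<Rightarrow> (real^'p::{finite,linorder}) set
     \<Rightarrow> (real^'q::finite) set \<Rightarrow> (real^'c) set \<Rightarrow> ('p,'q::finite) vfield set \<Rightarrow> bool" where
  "conditional_symmetries n lbl X U S L =
     (vf_lie_algebra X U L \<and>
      (\<forall>Z\<in>L. tangent_to (prolong n lbl Z) (S \<inter> char_system n lbl X U L)))"

end

theory Submission
  imports Defs
begin

text \<open>
  Solving the characteristic equations of \<open>L'\<close> of order zero for the first derivatives gives
  \<open>u\<^sub>i = f\<^sub>i(x,u)\<close>; since \<open>L'\<close> is Abelian, the vector fields \<open>E\<^sub>i = \<partial>\<^sub>i + f\<^sub>i \<partial>\<^sub>u\<close> on \<open>X \<times> U\<close> commute.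
  Hence \<open>u\<^sub>K = E\<^sub>K u\<close> is a well-defined section of \<open>J\<^sup>n\<close> over \<open>X \<times> U\<close>, along which total derivatives of
  functions of order less than \<open>n\<close> become derivatives along the \<open>E\<^sub>i\<close>, and the characteristic system
  is the image of this section. Conversely, as its fibres are single points, the \<open>x\<close>-components of \<open>L\<close>
  must also span at each of its points. For \<open>Z\<close> in \<open>L\<close> or \<open>L'\<close> the equation \<open>D\<^sub>K Q\<^sub>Z = 0\<close> on the system, for
  \<open>|K| < n\<close>, gives \<open>\<phi>\<^sub>K = \<Sum>\<^sub>i \<xi>\<^sub>i u\<^sub>K\<^sub>i\<close> there, and differentiating this once more along the section
  determines the components of the prolongation with \<open>|K| = n\<close>. So at a point of the characteristic system
  the prolongation of \<open>Z\<close> depends only on the \<open>x\<close>-component of \<open>Z\<close>, and \<open>L\<close> and \<open>L'\<close> prolong to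
  the same set of tangent vectors.
\<close>

section \<open>Smooth functions\<close>

lemma Ck_cong:
  assumes "open S" and "\<And>x. x \<in> S \<Longrightarrow> f x = g x" and "Ck k S f"
  shows "Ck k S g"
proof (cases k)
  case 0
  then show ?thesis using assms by (simp cong: continuous_on_cong)
next
  case (Suc m)
  then obtain f' where f': "\<forall>x\<in>S. (f has_derivative f' x) (at x)" "\<forall>v. Ck m S (\<lambda>x. f' x v)"
    using assms(3) by auto
  have "\<forall>x\<in>S. (g has_derivative f' x) (at x)"
    using f'(1) assms(1,2) by (metis has_derivative_transform_within_open)
  then show ?thesis using f'(2) Suc by auto
qed

lemma Ck_SucD: "Ck (Suc k) S f \<Longrightarrow> Ck k S f"
proof (induction k arbitrary: f)
  case 0
  then obtain f' where "\<forall>x\<in>S. (f has_derivative f' x) (at x)" by auto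
  then show ?case
    by (auto intro!: continuous_at_imp_continuous_on dest: has_derivative_continuous)
next
  case (Suc k)
  then obtain f' where "\<forall>x\<in>S. (f has_derivative f' x) (at x)" "\<forall>v. Ck (Suc k) S (\<lambda>x. f' x v)"
    by (auto simp del: Ck.simps simp: Ck.simps(2)[of "Suc k"])
  then show ?case using Suc.IH by auto
qed

lemma Ck_SucI:
  assumes "\<And>x. x \<in> S \<Longrightarrow> (f has_derivative f' x) (at x)" "\<And>v. Ck k S (\<lambda>x. f' x v)"
  shows "Ck (Suc k) S f"
  using assms by auto

lemma Ck_SucE:
  assumes "Ck (Suc k) S f"
  obtains f' where "\<And>x. x \<in> S \<Longrightarrow> (f has_derivative f' x) (at x)" "\<And>v. Ck k S (\<lambda>x. f' x v)"
  using assms by auto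

lemma Ck_add: "Ck k S f \<Longrightarrow> Ck k S g \<Longrightarrow> Ck k S (\<lambda>x. f x + g x)"
proof (induction k arbitrary: f g)
  case 0
  then show ?case by (simp add: continuous_on_add)
next
  case (Suc k)
  obtain f' where f': "\<And>x. x \<in> S \<Longrightarrow> (f has_derivative f' x) (at x)" "\<And>v. Ck k S (\<lambda>x. f' x v)"
    using Ck_SucE[OF Suc.prems(1)] by blast
  obtain g' where g': "\<And>x. x \<in> S \<Longrightarrow> (g has_derivative g' x) (at x)" "\<And>v. Ck k S (\<lambda>x. g' x v)"
    using Ck_SucE[OF Suc.prems(2)] by blast
  show ?case
    by (rule Ck_SucI[OF has_derivative_add[OF f'(1) g'(1)] Suc.IH[OF f'(2) g'(2)]])
qed

lemma Ck_bounded_linear: "bounded_linear T \<Longrightarrow> Ck k S f \<Longrightarrow> Ck k S (\<lambda>x. T (f x))"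
proof (induction k arbitrary: f)
  case 0
  then show ?case by (simp add: bounded_linear.continuous_on)
next
  case (Suc k)
  obtain f' where f': "\<And>x. x \<in> S \<Longrightarrow> (f has_derivative f' x) (at x)" "\<And>v. Ck k S (\<lambda>x. f' x v)"
    using Ck_SucE[OF Suc.prems(2)] by blast
  show ?case
    by (rule Ck_SucI[OF bounded_linear.has_derivative[OF Suc.prems(1) f'(1)]
        Suc.IH[OF Suc.prems(1) f'(2)]])
qed

lemma Ck_mult:
  fixes f g :: "'a::euclidean_space \<Rightarrow> real"
  shows "Ck k S f \<Longrightarrow> Ck k S g \<Longrightarrow> Ck k S (\<lambda>x. f x * g x)"
proof (induction k arbitrary: f g)
  case 0
  then show ?case by (simp add: continuous_on_mult)
next
  case (Suc k)
  obtain f' where f': "\<And>x. x \<in> S \<Longrightarrow> (f has_derivative f' x) (at x)" "\<And>v. Ck k S (\<lambda>x. f' x v)"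
    using Ck_SucE[OF Suc.prems(1)] by blast
  obtain g' where g': "\<And>x. x \<in> S \<Longrightarrow> (g has_derivative g' x) (at x)" "\<And>v. Ck k S (\<lambda>x. g' x v)"
    using Ck_SucE[OF Suc.prems(2)] by blast
  have fg: "Ck k S f" "Ck k S g" using Suc.prems Ck_SucD by blast+
  show ?case
    by (rule Ck_SucI[OF has_derivative_mult[OF f'(1) g'(1)]
        Ck_add[OF Suc.IH[OF fg(1) g'(2)] Suc.IH[OF f'(2) fg(2)]]])
qed

lemma Ck_const: "Ck k S (\<lambda>x. c)"
proof (induction k arbitrary: c)
  case (Suc k)
  show ?case by (rule Ck_SucI[OF has_derivative_const Suc.IH])
qed simp

lemma Ck_ident: "Ck k S (\<lambda>x. x)"
proof (cases k)
  case (Suc m)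
  show ?thesis unfolding Suc by (rule Ck_SucI[OF has_derivative_ident Ck_const])
qed simp

lemma Ck_inverse:
  fixes f :: "'a::euclidean_space \<Rightarrow> real"
  assumes "\<And>x. x \<in> S \<Longrightarrow> f x \<noteq> 0"
  shows "Ck k S f \<Longrightarrow> Ck k S (\<lambda>x. inverse (f x))"
proof (induction k)
  case 0
  then show ?case using assms by (simp add: continuous_on_inverse)
next
  case (Suc k)
  obtain f' where f': "\<And>x. x \<in> S \<Longrightarrow> (f has_derivative f' x) (at x)" "\<And>v. Ck k S (\<lambda>x. f' x v)"
    using Ck_SucE[OF Suc.prems(1)] by blast
  have inv: "Ck k S (\<lambda>x. inverse (f x))" using Suc.IH[OF Ck_SucD[OF Suc.prems]] .
  have "((\<lambda>x. inverse (f x)) has_derivative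
      (\<lambda>v. - (inverse (f x) * f' x v * inverse (f x)))) (at x)" if "x \<in> S" for x
    by (rule Deriv.has_derivative_inverse) (use assms f' that in auto)
  moreover have "Ck k S (\<lambda>x. - (inverse (f x) * f' x v * inverse (f x)))" for v
    by (rule Ck_bounded_linear[OF bounded_linear_minus[OF bounded_linear_ident]
          Ck_mult[OF Ck_mult[OF inv f'(2)] inv]])
  ultimately show ?case by (rule Ck_SucI)
qed

text \<open>Meant for pulling functions on X x U back along the linear projection
  \<open>base\<close>. For a linear inner map the derivative \<open>f' (T x) (T v)\<close> is, for
  fixed v, again a function precomposed with T, so the induction closes.\<close>

lemma Ck_linear_vimage:
  assumes "bounded_linear T"
  shows "Ck k S f \<Longrightarrow> Ck k (T -` S) (\<lambda>x. f (T x))"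
proof (induction k arbitrary: f)
  case 0
  then have "continuous_on S f" by simp
  from continuous_on_compose2[OF this linear_continuous_on[OF assms], of "T -` S"]
  show ?case by simp
next
  case (Suc k)
  obtain f' where f': "\<And>x. x \<in> S \<Longrightarrow> (f has_derivative f' x) (at x)" "\<And>v. Ck k S (\<lambda>x. f' x v)"
    using Ck_SucE[OF Suc.prems] by blast
  have "((\<lambda>x. f (T x)) has_derivative (\<lambda>v. f' (T x) (T v))) (at x)" if "x \<in> T -` S" for x
    by (rule has_derivative_compose[OF bounded_linear_imp_has_derivative[OF assms] f'(1)])
      (use that in simp)
  then show ?case by (rule Ck_SucI[OF _ Suc.IH[OF f'(2)]])
qed

lemma smooth_on_cong:
  assumes "open S" and "\<And>x. x \<in> S \<Longrightarrow> f x = g x" and "smooth_on S f"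
  shows "smooth_on S g"
  using assms Ck_cong unfolding smooth_on_def by blast

lemma smooth_on_const: "smooth_on S (\<lambda>x. c)"
  by (simp add: smooth_on_def Ck_const)

lemma smooth_on_bounded_linear:
  "bounded_linear T \<Longrightarrow> smooth_on S f \<Longrightarrow> smooth_on S (\<lambda>x. T (f x))"
  by (simp add: smooth_on_def Ck_bounded_linear)

lemma smooth_on_linear: "bounded_linear T \<Longrightarrow> smooth_on S T"
  using Ck_bounded_linear[OF _ Ck_ident] unfolding smooth_on_def by blast

lemma smooth_on_add: "smooth_on S f \<Longrightarrow> smooth_on S g \<Longrightarrow> smooth_on S (\<lambda>x. f x + g x)"
  by (simp add: smooth_on_def Ck_add)

lemma smooth_on_diff:
  assumes "smooth_on S f" "smooth_on S g"
  shows "smooth_on S (\<lambda>x. f x - g x)"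
  using smooth_on_add[OF assms(1) smooth_on_bounded_linear[OF bounded_linear_minus[OF bounded_linear_ident] assms(2)]]
  by simp

lemma smooth_on_mult:
  fixes f g :: "'a::euclidean_space \<Rightarrow> real"
  shows "smooth_on S f \<Longrightarrow> smooth_on S g \<Longrightarrow> smooth_on S (\<lambda>x. f x * g x)"
  by (simp add: smooth_on_def Ck_mult)

lemma smooth_on_sum:
  "(\<And>i. i \<in> I \<Longrightarrow> smooth_on S (f i)) \<Longrightarrow> smooth_on S (\<lambda>x. \<Sum>i\<in>I. f i x)"
  by (induction I rule: infinite_finite_induct) (simp_all add: smooth_on_const smooth_on_add)

lemma smooth_on_prod:
  fixes f :: "'i \<Rightarrow> 'a::euclidean_space \<Rightarrow> real"
  shows "(\<And>i. i \<in> I \<Longrightarrow> smooth_on S (f i)) \<Longrightarrow> smooth_on S (\<lambda>x. \<Prod>i\<in>I. f i x)"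
  by (induction I rule: infinite_finite_induct) (simp_all add: smooth_on_const smooth_on_mult)

lemma smooth_on_divide:
  fixes f g :: "'a::euclidean_space \<Rightarrow> real"
  assumes "smooth_on S f" "smooth_on S g" "\<And>x. x \<in> S \<Longrightarrow> g x \<noteq> 0"
  shows "smooth_on S (\<lambda>x. f x / g x)"
proof -
  have "smooth_on S (\<lambda>x. inverse (g x))"
    using assms(2) Ck_inverse[of S g, OF assms(3)] by (simp add: smooth_on_def)
  from smooth_on_mult[OF assms(1) this] show ?thesis by (simp add: divide_inverse)
qed

lemma smooth_on_vec:
  fixes f :: "'a::euclidean_space \<Rightarrow> real^'n"
  assumes "\<And>i. smooth_on S (\<lambda>x. f x $ i)"
  shows "smooth_on S f"
proof -
  have "smooth_on S (\<lambda>x. \<Sum>i\<in>UNIV. f x $ i *\<^sub>R (axis i 1 :: real^'n))"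
    using assms by (intro smooth_on_sum smooth_on_bounded_linear[OF bounded_linear_scaleR_left])
  moreover have "(\<lambda>x. \<Sum>i\<in>UNIV. f x $ i *\<^sub>R axis i 1) = f"
    using basis_expansion[of "f _"] by (simp add: scalar_mult_eq_scaleR)
  ultimately show ?thesis by simp
qed

lemma smooth_on_imp_differentiable:
  assumes "smooth_on S f" "x \<in> S"
  shows "f differentiable (at x)"
proof -
  have "Ck (Suc 0) S f" using assms(1) by (simp add: smooth_on_def)
  then show ?thesis using assms(2) by (auto simp: differentiable_def)
qed

lemma smooth_on_has_derivative:
  "smooth_on S f \<Longrightarrow> x \<in> S \<Longrightarrow> (f has_derivative frechet_derivative f (at x)) (at x)"
  by (simp add: smooth_on_imp_differentiable flip: frechet_derivative_works)

lemma smooth_on_imp_continuous_on: "smooth_on S f \<Longrightarrow> continuous_on S f"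
  unfolding smooth_on_def using Ck.simps(1) by blast

lemma smooth_on_frechet_derivative:
  assumes "open S" "smooth_on S f"
  shows "smooth_on S (\<lambda>x. frechet_derivative f (at x) v)"
  unfolding smooth_on_def
proof
  fix k
  have "Ck (Suc k) S f" using assms(2) by (simp add: smooth_on_def)
  then obtain f' where f': "\<And>x. x \<in> S \<Longrightarrow> (f has_derivative f' x) (at x)" "\<And>v. Ck k S (\<lambda>x. f' x v)"
    using Ck_SucE by blast
  have "f' x v = frechet_derivative f (at x) v" if "x \<in> S" for x
    using fun_cong[OF frechet_derivative_at[OF f'(1)[OF that]]] .
  from Ck_cong[OF assms(1) this f'(2)]
  show "Ck k S (\<lambda>x. frechet_derivative f (at x) v)" .
qed

lemma linear_frechet_smooth_on:
  "smooth_on S f \<Longrightarrow> x \<in> S \<Longrightarrow> linear (frechet_derivative f (at x))"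
  by (intro linear_frechet_derivative smooth_on_imp_differentiable)

lemma frechet_derivative_Basis_expansion:
  fixes f :: "'a::euclidean_space \<Rightarrow> real"
  assumes "smooth_on S f" "x \<in> S"
  shows "frechet_derivative f (at x) w = (\<Sum>b\<in>Basis. (w \<bullet> b) * frechet_derivative f (at x) b)"
proof -
  interpret linear "frechet_derivative f (at x)" using linear_frechet_smooth_on[OF assms] .
  have "frechet_derivative f (at x) w = frechet_derivative f (at x) (\<Sum>b\<in>Basis. (w \<bullet> b) *\<^sub>R b)"
    by (simp only: euclidean_representation)
  also have "\<dots> = (\<Sum>b\<in>Basis. (w \<bullet> b) * frechet_derivative f (at x) b)"
    by (simp only: sum scale real_scaleR_def)
  finally show ?thesis .
qed

text \<open>Expanding the point-dependent direction in the basis leaves derivatives in fixed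
  directions with smooth coefficients.\<close>

lemma smooth_on_frechet_derivative_along:
  fixes f :: "'a::euclidean_space \<Rightarrow> real"
  assumes "open S" "smooth_on S f" "smooth_on S w"
  shows "smooth_on S (\<lambda>x. frechet_derivative f (at x) (w x))"
proof (rule smooth_on_cong[OF assms(1)])
  show "smooth_on S (\<lambda>x. \<Sum>b\<in>Basis. (w x \<bullet> b) * frechet_derivative f (at x) b)"
    using assms
    by (intro smooth_on_sum smooth_on_mult smooth_on_frechet_derivative
        smooth_on_bounded_linear[OF bounded_linear_inner_left])
qed (simp add: frechet_derivative_Basis_expansion[OF assms(2), symmetric])

lemma frechet_derivative_cong_open:
  assumes "open S" "x \<in> S" "smooth_on S f" "\<And>y. y \<in> S \<Longrightarrow> f y = g y"
  shows "frechet_derivative f (at x) = frechet_derivative g (at x)"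
  using frechet_derivative_transform_within_open[OF smooth_on_imp_differentiable[OF assms(3,2)] assms(1,2,4)] .

section \<open>Symmetry of second derivatives and derivatives along vector fields\<close>

text \<open>The second difference is the increment over [0,t] of \<open>?h\<close>, which compares g
  on two parallel lines in direction v. The mean value theorem turns it into t times an increment of
  the v-derivative in direction w, and a second application produces the mixed derivative.\<close>

lemma second_difference_mvt:
  fixes g :: "'a::euclidean_space \<Rightarrow> real"
  assumes "smooth_on S g" "open S" "t > 0" "cball z (t * (norm v + norm w)) \<subseteq> S"
  shows "\<exists>p\<in>cball z (t * (norm v + norm w)).
     g (z + t *\<^sub>R v + t *\<^sub>R w) - g (z + t *\<^sub>R v) - g (z + t *\<^sub>R w) + g z
       = t\<^sup>2 * frechet_derivative (\<lambda>y. frechet_derivative g (at y) v) (at p) w"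
proof -
  have in_cball: "z + a *\<^sub>R v + b *\<^sub>R w \<in> cball z (t * (norm v + norm w))"
    if "0 \<le> a" "a \<le> t" "0 \<le> b" "b \<le> t" for a b
  proof -
    have "norm (a *\<^sub>R v + b *\<^sub>R w) \<le> a * norm v + b * norm w"
      using norm_triangle_ineq[of "a *\<^sub>R v" "b *\<^sub>R w"] that by simp
    also have "\<dots> \<le> t * norm v + t * norm w" using that by (intro add_mono mult_right_mono) auto
    finally show ?thesis by (simp add: dist_norm norm_minus_commute algebra_simps)
  qed
  have line: "((\<lambda>a. h (y + a *\<^sub>R u)) has_real_derivative frechet_derivative h (at (y + a *\<^sub>R u)) u) (at a)"
    if "smooth_on S h" "y + a *\<^sub>R u \<in> S" for h :: "'a \<Rightarrow> real" and y u :: 'a and a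
  proof -
    have "((\<lambda>a. y + a *\<^sub>R u) has_derivative (\<lambda>a. a *\<^sub>R u)) (at a)"
      by (auto intro!: derivative_eq_intros)
    from has_derivative_compose[OF this smooth_on_has_derivative[OF that]]
    have "((\<lambda>a. h (y + a *\<^sub>R u)) has_derivative (\<lambda>a'. frechet_derivative h (at (y + a *\<^sub>R u)) (a' *\<^sub>R u))) (at a)" .
    then show ?thesis
      by (simp add: has_field_derivative_def linear_scale[OF linear_frechet_smooth_on[OF that]] mult.commute[of _ "frechet_derivative _ _ _"])
  qed
  let ?d = "\<lambda>y. frechet_derivative g (at y) v"
  let ?h = "\<lambda>a. g (z + t *\<^sub>R w + a *\<^sub>R v) - g (z + a *\<^sub>R v)"
  have "(?h has_real_derivative ?d (z + t *\<^sub>R w + a *\<^sub>R v) - ?d (z + a *\<^sub>R v)) (at a)"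
    if "0 \<le> a" "a \<le> t" for a
  proof (intro DERIV_diff line assms(1))
    show "z + t *\<^sub>R w + a *\<^sub>R v \<in> S" using in_cball[of a t] that assms(3,4) by (auto simp: algebra_simps)
    show "z + a *\<^sub>R v \<in> S" using in_cball[of a 0] that assms(3,4) by auto
  qed
  from MVT2[OF assms(3) this] obtain a where a: "0 < a" "a < t" and
    ha: "?h t - ?h 0 = (t - 0) * (?d (z + t *\<^sub>R w + a *\<^sub>R v) - ?d (z + a *\<^sub>R v))" by auto
  have "((\<lambda>b. ?d (z + a *\<^sub>R v + b *\<^sub>R w)) has_real_derivative
      frechet_derivative ?d (at (z + a *\<^sub>R v + b *\<^sub>R w)) w) (at b)" if "0 \<le> b" "b \<le> t" for b
    using in_cball[of a b] that a assms(4)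
    by (intro line smooth_on_frechet_derivative assms(1,2)) auto
  from MVT2[OF assms(3) this] obtain b where b: "0 < b" "b < t" and
    hb: "?d (z + a *\<^sub>R v + t *\<^sub>R w) - ?d (z + a *\<^sub>R v + 0 *\<^sub>R w) =
      (t - 0) * frechet_derivative ?d (at (z + a *\<^sub>R v + b *\<^sub>R w)) w" by auto
  have "g (z + t *\<^sub>R v + t *\<^sub>R w) - g (z + t *\<^sub>R v) - g (z + t *\<^sub>R w) + g z = ?h t - ?h 0"
    by (simp add: algebra_simps)
  also have "\<dots> = t\<^sup>2 * frechet_derivative ?d (at (z + a *\<^sub>R v + b *\<^sub>R w)) w"
    unfolding ha using hb by (simp add: algebra_simps power2_eq_square)
  finally show ?thesis using in_cball[of a b] a b by (intro bexI) auto
qed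

text \<open>The second difference is unchanged when v and w are exchanged, so the two mixed
  derivatives take equal values at some p and q arbitrarily close to z; continuity then excludes a
  gap at z.\<close>

lemma frechet_derivative_commute:
  fixes g :: "'a::euclidean_space \<Rightarrow> real"
  assumes "smooth_on S g" "open S" "z \<in> S"
  shows "frechet_derivative (\<lambda>y. frechet_derivative g (at y) v) (at z) w =
    frechet_derivative (\<lambda>y. frechet_derivative g (at y) w) (at z) v"
    (is "?A z = ?B z")
proof (rule ccontr)
  assume ne: "?A z \<noteq> ?B z"
  define e where "e = dist (?A z) (?B z) / 2"
  have e: "e > 0" using ne by (simp add: e_def)
  have cont: "continuous_on S (\<lambda>z. ?A z)" "continuous_on S (\<lambda>z. ?B z)"
    using assms by (auto intro!: smooth_on_imp_continuous_on smooth_on_frechet_derivative)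
  obtain d1 where d1: "d1 > 0" "\<And>y. y \<in> S \<Longrightarrow> dist y z < d1 \<Longrightarrow> dist (?A y) (?A z) < e"
    using cont(1)[unfolded continuous_on_iff, rule_format, OF assms(3) e] by auto
  obtain d2 where d2: "d2 > 0" "\<And>y. y \<in> S \<Longrightarrow> dist y z < d2 \<Longrightarrow> dist (?B y) (?B z) < e"
    using cont(2)[unfolded continuous_on_iff, rule_format, OF assms(3) e] by auto
  obtain d3 where d3: "d3 > 0" "cball z d3 \<subseteq> S"
    using assms(2,3) open_contains_cball by blast
  \<comment> \<open>The summand 1 keeps N positive even if v and w both vanish. The step t is chosen
    so that the parallelogram stays within distance d of z, where the inclusion in S and both
    continuity estimates hold.\<close>
  define N where "N = norm v + norm w + 1"
  define d where "d = min d3 (min d1 d2 / 2)"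
  define t where "t = d / N"
  have N: "N > 0" "norm v + norm w \<le> N"
    unfolding N_def using norm_ge_zero[of v] norm_ge_zero[of w] by linarith+
  have d: "d > 0" "d \<le> d3" "d < d1" "d < d2" using d1 d2 d3 by (auto simp: d_def min_def)
  have t: "t > 0" using d N by (simp add: t_def)
  have "t * (norm v + norm w) \<le> t * N" using N t by (intro mult_left_mono) auto
  then have td: "t * (norm v + norm w) \<le> d" using N by (simp add: t_def)
  have sub: "cball z (t * (norm v + norm w)) \<subseteq> S" using td d d3 by force
  obtain p where p: "p \<in> cball z (t * (norm v + norm w))"
    "g (z + t *\<^sub>R v + t *\<^sub>R w) - g (z + t *\<^sub>R v) - g (z + t *\<^sub>R w) + g z = t\<^sup>2 * ?A p"
    using second_difference_mvt[OF assms(1,2) t sub] by blast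
  obtain q where q: "q \<in> cball z (t * (norm v + norm w))"
    "g (z + t *\<^sub>R w + t *\<^sub>R v) - g (z + t *\<^sub>R w) - g (z + t *\<^sub>R v) + g z = t\<^sup>2 * ?B q"
    using second_difference_mvt[OF assms(1,2) t, of z w v] sub by (auto simp: add.commute)
  have "t\<^sup>2 * ?A p = t\<^sup>2 * ?B q" using p(2) q(2) by (simp add: algebra_simps)
  then have "?A p = ?B q" using t by simp
  moreover have "dist (?A p) (?A z) < e"
    using p(1) sub td d by (intro d1) (auto simp: dist_commute)
  moreover have "dist (?B q) (?B z) < e"
    using q(1) sub td d by (intro d2) (auto simp: dist_commute)
  moreover have "dist (?A z) (?B z) \<le> dist (?A p) (?A z) + dist (?B q) (?B z)"
    using dist_triangle3[of "?A z" "?B z" "?A p"] \<open>?A p = ?B q\<close> by simp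
  ultimately show False unfolding e_def by linarith
qed

lemma smooth_on_Pair:
  assumes "smooth_on S f" "smooth_on S g"
  shows "smooth_on S (\<lambda>x. (f x, g x))"
proof -
  from smooth_on_add[OF
      smooth_on_bounded_linear[OF bounded_linear_Pair[OF bounded_linear_ident bounded_linear_zero] assms(1)]
      smooth_on_bounded_linear[OF bounded_linear_Pair[OF bounded_linear_zero bounded_linear_ident] assms(2)]]
  show ?thesis by simp
qed

text \<open>Product rule, read off from the expansion in basis directions. When two fields are
  exchanged, the terms with frozen direction cancel by symmetry, and what remains is the derivative
  along the bracket.\<close>

lemma frechet_derivative_along:
  fixes g :: "'a::euclidean_space \<Rightarrow> real"
  assumes "open S" "z \<in> S" "smooth_on S g" "smooth_on S w"
  shows "frechet_derivative (\<lambda>y. frechet_derivative g (at y) (w y)) (at z) v =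
    frechet_derivative g (at z) (frechet_derivative w (at z) v)
    + frechet_derivative (\<lambda>y. frechet_derivative g (at y) (w z)) (at z) v"
proof -
  let ?d = "\<lambda>b y. frechet_derivative g (at y) b"
  let ?D = "\<lambda>b. frechet_derivative (?d b) (at z)"
  let ?w = "frechet_derivative w (at z)"
  have d: "(?d b has_derivative ?D b) (at z)" for b
    by (rule smooth_on_has_derivative[OF smooth_on_frechet_derivative[OF assms(1,3)] assms(2)])
  have w: "(w has_derivative ?w) (at z)"
    by (rule smooth_on_has_derivative[OF assms(4,2)])
  have expand: "frechet_derivative g (at y) u = (\<Sum>b\<in>Basis. (u \<bullet> b) * ?d b y)" if "y \<in> S" for y u
    using frechet_derivative_Basis_expansion[OF assms(3) that] .
  have "((\<lambda>y. \<Sum>b\<in>Basis. (w y \<bullet> b) * ?d b y) has_derivative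
      (\<lambda>v. \<Sum>b\<in>Basis. (w z \<bullet> b) * ?D b v + (?w v \<bullet> b) * ?d b z)) (at z)"
    by (rule has_derivative_sum[OF has_derivative_mult[OF has_derivative_inner_left[OF w] d]])
  then have "((\<lambda>y. ?d (w y) y) has_derivative
      (\<lambda>v. \<Sum>b\<in>Basis. (w z \<bullet> b) * ?D b v + (?w v \<bullet> b) * ?d b z)) (at z)"
    by (rule has_derivative_transform_within_open[OF _ assms(1,2)]) (simp add: expand)
  from fun_cong[OF frechet_derivative_at[OF this], of v]
  have 1: "frechet_derivative (\<lambda>y. ?d (w y) y) (at z) v =
      (\<Sum>b\<in>Basis. (w z \<bullet> b) * ?D b v) + (\<Sum>b\<in>Basis. (?w v \<bullet> b) * ?d b z)"
    by (simp add: sum.distrib)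
  have "((\<lambda>y. \<Sum>b\<in>Basis. (w z \<bullet> b) * ?d b y) has_derivative
      (\<lambda>v. \<Sum>b\<in>Basis. (w z \<bullet> b) * ?D b v)) (at z)"
    by (rule has_derivative_sum[OF has_derivative_mult_right[OF d]])
  then have "((\<lambda>y. ?d (w z) y) has_derivative (\<lambda>v. \<Sum>b\<in>Basis. (w z \<bullet> b) * ?D b v)) (at z)"
    by (rule has_derivative_transform_within_open[OF _ assms(1,2)]) (simp add: expand)
  from fun_cong[OF frechet_derivative_at[OF this], of v]
  have 2: "frechet_derivative (\<lambda>y. ?d (w z) y) (at z) v = (\<Sum>b\<in>Basis. (w z \<bullet> b) * ?D b v)"
    by simp
  show ?thesis
    unfolding 1 2 expand[OF assms(2), of "?w v"] by (simp only: add.commute)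
qed


section \<open>Functions on the jet space and their order\<close>

text \<open>Equality of the projections to J^m, for m \<le> n.\<close>

definition agree :: "('c \<Rightarrow> ('p::finite,'q) jlab) \<Rightarrow> nat \<Rightarrow> real^'c \<Rightarrow> real^'c \<Rightarrow> bool" where
  "agree lbl m P P' \<longleftrightarrow> (\<forall>i. crd lbl (JX i) P = crd lbl (JX i) P') \<and>
     (\<forall>a K. size K \<le> m \<longrightarrow> crd lbl (JU a K) P = crd lbl (JU a K) P')"

lemma agree_mono: "agree lbl k P P' \<Longrightarrow> m \<le> k \<Longrightarrow> agree lbl m P P'"
  unfolding agree_def by force

lemma agree_sym: "agree lbl m P P' \<Longrightarrow> agree lbl m P' P"
  by (simp add: agree_def)

lemma agree_base: "agree lbl m P P' \<Longrightarrow> base lbl P = base lbl P'"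
  by (simp add: agree_def base_def xpt_def upt_def)

lemma bounded_linear_crd: "bounded_linear (crd lbl l)"
  unfolding crd_def by (rule bounded_linear_vec_nth)

lemma crd_add: "crd lbl l (P + Q) = crd lbl l P + crd lbl l Q"
  and crd_diff: "crd lbl l (P - Q) = crd lbl l P - crd lbl l Q"
  and crd_scaleR: "crd lbl l (t *\<^sub>R P) = t * crd lbl l P"
  and crd_0: "crd lbl l 0 = 0"
  by (simp_all add: crd_def)

lemma bounded_linear_base: "bounded_linear (base lbl)"
  unfolding linear_conv_bounded_linear[symmetric]
  by (rule linearI) (auto simp: base_def xpt_def upt_def crd_add crd_scaleR vec_eq_iff)

locale jet =
  fixes X :: "(real^'p::{finite,linorder}) set" and U :: "(real^'q::finite) set"
    and n :: nat and lbl :: "'c::finite \<Rightarrow> ('p,'q) jlab"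
  assumes open_X: "open X" and open_U: "open U" and n_pos: "n \<ge> 1"
    and bij_lbl: "bij_betw lbl UNIV (jlabs n)"
begin

abbreviation "W \<equiv> X \<times> U"
abbreviation "J \<equiv> jet_space lbl X U"

lemma open_W: "open W"
  by (simp add: open_Times open_X open_U)

lemma J_iff: "P \<in> J \<longleftrightarrow> base lbl P \<in> W"
  by (simp add: jet_space_def)

lemma J_vimage: "J = base lbl -` W"
  by (auto simp: jet_space_def)

lemma open_J: "open J"
  unfolding J_vimage by (rule open_vimage[OF open_W linear_continuous_on[OF bounded_linear_base]])

lemma inv_lbl [simp]: "inv lbl (lbl c) = c"
  using bij_lbl by (simp add: bij_betw_def inv_f_f)

lemma lbl_inv: "l \<in> jlabs n \<Longrightarrow> lbl (inv lbl l) = l"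
  using bij_lbl by (simp add: bij_betw_def f_inv_into_f)

lemma lbl_in: "lbl c \<in> jlabs n"
  using bij_lbl by (auto simp: bij_betw_def)

lemma JX_in [simp]: "JX i \<in> jlabs n"
  and JU_in [simp]: "JU a K \<in> jlabs n \<longleftrightarrow> size K \<le> n"
  by (auto simp: jlabs_def)

text \<open>The chart \<open>lbl\<close> identifies the labels of order at most n with the finite
  type \<open>'c\<close>, and multisets embed into the labels.\<close>

lemma finite_msets_le: "finite {K :: 'p multiset. size K \<le> n}"
proof -
  have "finite (jlabs n :: ('p,'q) jlab set)"
    using bij_betw_finite[OF bij_lbl] by simp
  moreover have "JU a ` {K. size K \<le> n} \<subseteq> jlabs n" for a :: 'q
    by (auto simp: jlabs_def)
  ultimately have "finite (JU a ` {K :: 'p multiset. size K \<le> n})" for a :: 'q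
    by (rule finite_subset[rotated])
  then show ?thesis by (rule finite_imageD) (simp add: inj_on_def)
qed

lemma sum_labels:
  "(\<Sum>c\<in>UNIV. h c :: real) = (\<Sum>k\<in>UNIV. h (inv lbl (JX k)))
     + (\<Sum>(a,K)\<in>UNIV \<times> {K. size K \<le> n}. h (inv lbl (JU a K)))"
proof -
  let ?T = "UNIV \<times> {K :: 'p multiset. size K \<le> n} :: ('q \<times> 'p multiset) set"
  have split: "jlabs n = range JX \<union> (\<lambda>(a,K). JU a K) ` ?T"
    by (auto simp: jlabs_def)
  have "(\<Sum>c\<in>UNIV. h c) = (\<Sum>c\<in>UNIV. h (inv lbl (lbl c)))" by simp
  also have "\<dots> = (\<Sum>l\<in>jlabs n. h (inv lbl l))"
    by (rule sum.reindex_bij_betw[OF bij_lbl])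
  also have "\<dots> = (\<Sum>l\<in>range JX. h (inv lbl l)) + (\<Sum>l\<in>(\<lambda>(a,K). JU a K) ` ?T. h (inv lbl l))"
    unfolding split
  proof (rule sum.union_disjoint)
    show "finite ((\<lambda>(a,K). JU a K) ` ?T)"
      by (intro finite_imageI finite_cartesian_product finite finite_msets_le)
  qed auto
  also have "(\<Sum>l\<in>range JX. h (inv lbl l)) = (\<Sum>k\<in>UNIV. h (inv lbl (JX k)))"
    by (subst sum.reindex) (auto simp: inj_on_def)
  also have "(\<Sum>l\<in>(\<lambda>(a,K). JU a K) ` ?T. h (inv lbl l)) = (\<Sum>(a,K)\<in>?T. h (inv lbl (JU a K)))"
    by (subst sum.reindex) (auto simp: inj_on_def case_prod_unfold)
  finally show ?thesis .
qed

text \<open>The value at \<open>P\<close> of the truncated total derivative, as a tangent vector: differentiating along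
  it is a derivation, which \<^const>\<open>tderiv\<close> only is where its argument is differentiable.\<close>
definition tvec :: "'p \<Rightarrow> real^'c \<Rightarrow> real^'c" where
  "tvec i P = (\<chi> c. case lbl c of JX k \<Rightarrow> if k = i then 1 else 0
     | JU a K \<Rightarrow> if size K < n then crd lbl (JU a (K + {#i#})) P else 0)"

lemma crd_tvec:
  "crd lbl (JX k) (tvec i P) = (if k = i then 1 else 0)"
  "size K \<le> n \<Longrightarrow> crd lbl (JU a K) (tvec i P) = (if size K < n then crd lbl (JU a (K + {#i#})) P else 0)"
  unfolding tvec_def crd_def by (simp_all add: lbl_inv)

lemma tderiv_eq:
  assumes "smooth_on J g" "P \<in> J"
  shows "tderiv n lbl i g P = frechet_derivative g (at P) (tvec i P)"
proof -
  interpret D: linear "frechet_derivative g (at P)" using linear_frechet_smooth_on[OF assms] .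
  let ?D = "frechet_derivative g (at P)"
  have "?D (tvec i P) = ?D (\<Sum>c\<in>UNIV. tvec i P $ c *\<^sub>R axis c 1)"
    using basis_expansion[of "tvec i P"] by (simp add: scalar_mult_eq_scaleR)
  also have "\<dots> = (\<Sum>c\<in>UNIV. tvec i P $ c * ?D (axis c 1))"
    by (simp add: D.sum D.scale)
  also have "\<dots> = (\<Sum>k\<in>UNIV. crd lbl (JX k) (tvec i P) * pd lbl (JX k) g P)
     + (\<Sum>(a,K)\<in>UNIV \<times> {K. size K \<le> n}. crd lbl (JU a K) (tvec i P) * pd lbl (JU a K) g P)"
    unfolding sum_labels by (simp add: crd_def pd_def)
  also have "(\<Sum>k\<in>UNIV. crd lbl (JX k) (tvec i P) * pd lbl (JX k) g P) = pd lbl (JX i) g P"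
    by (simp add: crd_tvec if_distrib[of "\<lambda>x. x * _"] cong: if_cong)
  \<comment> \<open>The components of \<open>tvec\<close> of order exactly n are zero, which matches
    the truncated sum in \<open>tderiv\<close>.\<close>
  also have "(\<Sum>(a,K)\<in>UNIV \<times> {K. size K \<le> n}. crd lbl (JU a K) (tvec i P) * pd lbl (JU a K) g P)
    = (\<Sum>(a,K)\<in>UNIV \<times> {K. size K < n}. crd lbl (JU a (K + {#i#})) P * pd lbl (JU a K) g P)"
  proof (rule sum.mono_neutral_cong_right)
    show "finite (UNIV \<times> {K :: 'p multiset. size K \<le> n} :: ('q \<times> 'p multiset) set)"
      by (intro finite_cartesian_product finite finite_msets_le)
  qed (auto simp: crd_tvec split: if_splits)
  finally show ?thesis by (simp add: tderiv_def)
qed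

lemma smooth_crd: "smooth_on S (crd lbl l)"
  using smooth_on_linear[OF bounded_linear_crd] .

lemma smooth_base_comp: "smooth_on W f \<Longrightarrow> smooth_on J (\<lambda>P. f (base lbl P))"
  unfolding J_vimage smooth_on_def by (simp add: Ck_linear_vimage[OF bounded_linear_base])

lemma smooth_tderiv: "smooth_on J g \<Longrightarrow> smooth_on J (tderiv n lbl i g)"
  unfolding tderiv_def[abs_def] pd_def case_prod_unfold
  by (intro smooth_on_add smooth_on_sum smooth_on_mult smooth_crd smooth_on_frechet_derivative open_J)

lemma tderiv_cong:
  assumes "smooth_on J g" "P \<in> J" "\<And>Q. Q \<in> J \<Longrightarrow> g Q = h Q"
  shows "tderiv n lbl i g P = tderiv n lbl i h P"
  using frechet_derivative_cong_open[OF open_J assms(2,1,3)] by (simp add: tderiv_def pd_def)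

lemma tderiv_add:
  assumes "smooth_on J g" "smooth_on J h" "P \<in> J"
  shows "tderiv n lbl i (\<lambda>Q. g Q + h Q) P = tderiv n lbl i g P + tderiv n lbl i h P"
proof -
  have "((\<lambda>Q. g Q + h Q) has_derivative
      (\<lambda>v. frechet_derivative g (at P) v + frechet_derivative h (at P) v)) (at P)"
    using assms by (intro has_derivative_add smooth_on_has_derivative)
  from fun_cong[OF frechet_derivative_at[OF this], of "tvec i P"] show ?thesis
    using assms by (simp add: tderiv_eq smooth_on_add)
qed

lemma tderiv_mult:
  assumes "smooth_on J g" "smooth_on J h" "P \<in> J"
  shows "tderiv n lbl i (\<lambda>Q. g Q * h Q) P = g P * tderiv n lbl i h P + tderiv n lbl i g P * h P"
proof -
  have "((\<lambda>Q. g Q * h Q) has_derivative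
      (\<lambda>v. g P * frechet_derivative h (at P) v + frechet_derivative g (at P) v * h P)) (at P)"
    using assms by (intro has_derivative_mult smooth_on_has_derivative)
  from fun_cong[OF frechet_derivative_at[OF this], of "tvec i P"] show ?thesis
    using assms by (simp add: tderiv_eq smooth_on_mult)
qed

lemma tderiv_const: "tderiv n lbl i (\<lambda>Q. c) P = 0"
  by (simp add: tderiv_def pd_def)

lemma tderiv_sum:
  assumes "finite I" "\<And>k. k \<in> I \<Longrightarrow> smooth_on J (g k)" "P \<in> J"
  shows "tderiv n lbl i (\<lambda>Q. \<Sum>k\<in>I. g k Q) P = (\<Sum>k\<in>I. tderiv n lbl i (g k) P)"
  using assms by (induction I rule: finite_induct) (simp_all add: tderiv_const tderiv_add smooth_on_sum)

lemma tderiv_diff: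
  assumes "smooth_on J g" "smooth_on J h" "P \<in> J"
  shows "tderiv n lbl i (\<lambda>Q. g Q - h Q) P = tderiv n lbl i g P - tderiv n lbl i h P"
  using tderiv_add[OF assms(1) smooth_on_mult[OF smooth_on_const[of _ "-1"] assms(2)] assms(3), of i]
    tderiv_mult[OF smooth_on_const[of _ "-1"] assms(2,3), of i]
  by (simp add: tderiv_const)

lemma tderiv_crd_JU:
  assumes "size K < n" "P \<in> J"
  shows "tderiv n lbl i (crd lbl (JU a K)) P = crd lbl (JU a (K + {#i#})) P"
proof -
  have "frechet_derivative (crd lbl (JU a K)) (at P) = crd lbl (JU a K)"
    using frechet_derivative_at[OF bounded_linear_imp_has_derivative[OF bounded_linear_crd]] by metis
  then show ?thesis using assms by (simp add: tderiv_eq[OF smooth_crd] crd_tvec)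
qed

section \<open>Order of a function on the jet space\<close>

text \<open>For m \<le> n these are the functions that factor through the projection to J^m. If m <
  n, the truncation in \<open>tderiv\<close> does not affect them, since it only drops the partial
  derivatives with respect to coordinates of order n.\<close>

definition ord :: "nat \<Rightarrow> (real^'c \<Rightarrow> real) \<Rightarrow> bool" where
  "ord m g \<longleftrightarrow> (\<forall>P\<in>J. \<forall>P'\<in>J. agree lbl m P P' \<longrightarrow> g P = g P')"

lemma ordD: "ord m g \<Longrightarrow> P \<in> J \<Longrightarrow> P' \<in> J \<Longrightarrow> agree lbl m P P' \<Longrightarrow> g P = g P'"
  by (auto simp: ord_def)

lemma ord_mono: "ord m g \<Longrightarrow> m \<le> k \<Longrightarrow> ord k g"
  unfolding ord_def using agree_mono by blast

lemma ord_crd: "size K \<le> m \<Longrightarrow> ord m (crd lbl (JU a K))"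
  by (auto simp: ord_def agree_def)

lemma ord_base: "ord m (\<lambda>P. f (base lbl P))"
  unfolding ord_def using agree_base by metis

lemma ord_diff: "ord m g \<Longrightarrow> ord m h \<Longrightarrow> ord m (\<lambda>P. g P - h P)"
  and ord_mult: "ord m g \<Longrightarrow> ord m h \<Longrightarrow> ord m (\<lambda>P. g P * h P)"
  unfolding ord_def by (metis (no_types, lifting))+

lemma ord_sum: "(\<And>k. k \<in> I \<Longrightarrow> ord m (g k)) \<Longrightarrow> ord m (\<lambda>P. \<Sum>k\<in>I. g k P)"
  unfolding ord_def by (meson sum.cong)

lemma agree_in_J: "agree lbl m P P' \<Longrightarrow> P \<in> J \<Longrightarrow> P' \<in> J"
  by (simp add: J_iff agree_base)

lemma agree_add: "agree lbl m P P' \<Longrightarrow> agree lbl m (Q + P) (Q + P')"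
  by (simp add: agree_def crd_add)

text \<open>Translation by \<open>P - P'\<close> changes no coordinate that g depends on, so it
  preserves g; its differential is the identity.\<close>

lemma frechet_derivative_agree:
  assumes "ord m g" "smooth_on J g" "P \<in> J" "agree lbl m P P'"
  shows "frechet_derivative g (at P') = frechet_derivative g (at P)"
proof -
  have P': "P' \<in> J" using assms agree_in_J by blast
  have agr: "agree lbl m (Q + (P - P')) Q" for Q
    using agree_add[OF assms(4), of "Q - P'"] by (simp add: algebra_simps)
  have "((\<lambda>Q. Q + (P - P')) has_derivative (\<lambda>v. v)) (at P')"
    by (auto intro!: derivative_eq_intros)
  from has_derivative_compose[OF this, of g "frechet_derivative g (at P)"]
  have "((\<lambda>Q. g (Q + (P - P'))) has_derivative frechet_derivative g (at P)) (at P')"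
    using smooth_on_has_derivative[OF assms(2,3)] by simp
  then have "(g has_derivative frechet_derivative g (at P)) (at P')"
  proof (rule has_derivative_transform_within_open[OF _ open_J P'])
    fix Q assume "Q \<in> J"
    then show "g (Q + (P - P')) = g Q"
      using agr[of Q] agree_in_J[OF agree_sym[OF agr[of Q]]] assms(1) ordD by blast
  qed
  then show ?thesis by (rule frechet_derivative_at[symmetric])
qed

text \<open>The line through P in direction w stays in one fibre, on which g is constant.\<close>

lemma frechet_derivative_vertical:
  assumes "ord m g" "smooth_on J g" "P \<in> J" "agree lbl m w 0"
  shows "frechet_derivative g (at P) w = 0"
proof -
  have agr: "agree lbl m (P + t *\<^sub>R w) P" for t
    using assms(4) by (simp add: agree_def crd_add crd_scaleR) (simp add: crd_def)
  have const: "g (P + t *\<^sub>R w) = g P" for t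
    using agr[of t] agree_in_J[OF agree_sym[OF agr[of t]] assms(3)] assms(1,3) ordD by blast
  have "((\<lambda>t. P + t *\<^sub>R w) has_derivative (\<lambda>t. t *\<^sub>R w)) (at (0::real))"
    by (auto intro!: derivative_eq_intros)
  from has_derivative_compose[OF this, of g "frechet_derivative g (at P)"]
  have "((\<lambda>t. g P) has_derivative (\<lambda>t. frechet_derivative g (at P) (t *\<^sub>R w))) (at (0::real))"
    using smooth_on_has_derivative[OF assms(2,3)] by (simp add: const)
  then have "(\<lambda>t::real. frechet_derivative g (at P) (t *\<^sub>R w)) = (\<lambda>t. 0)"
    using has_derivative_unique has_derivative_const by blast
  from fun_cong[OF this, of 1] show ?thesis by simp
qed

lemma ord_tderiv:
  assumes "ord m g" "smooth_on J g" "m \<le> n"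
  shows "ord (Suc m) (tderiv n lbl i g)"
  unfolding ord_def
proof (intro ballI impI)
  fix P P' assume P: "P \<in> J" "P' \<in> J" and agr: "agree lbl (Suc m) P P'"
  have eq: "frechet_derivative g (at P') = frechet_derivative g (at P)"
    using frechet_derivative_agree[OF assms(1,2) P(1)] agree_mono[OF agr] by simp
  have lin: "linear (frechet_derivative g (at P))" using linear_frechet_smooth_on[OF assms(2) P(1)] .
  \<comment> \<open>Up to order m the components of \<open>tvec\<close> are constants or coordinates
    of order at most m + 1, so the two vectors differ only in directions that g does not
    see.\<close>
  have "agree lbl m (tvec i P - tvec i P') 0"
    using agr assms(3) by (auto simp: agree_def crd_diff crd_tvec crd_0)
  then have "frechet_derivative g (at P) (tvec i P - tvec i P') = 0"
    using frechet_derivative_vertical[OF assms(1,2) P(1)] by blast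
  then show "tderiv n lbl i g P = tderiv n lbl i g P'"
    using assms(2) P eq lin by (simp add: tderiv_eq linear_diff)
qed

end


section \<open>Characteristics and prolongations\<close>

context jet
begin

lemma smooth_on_vfield: "is_vfield X U Y \<Longrightarrow> smooth_on W Y"
  by (simp add: is_vfield_def)

lemma smooth_on_fst_vfield: "is_vfield X U Y \<Longrightarrow> smooth_on W (\<lambda>z. fst (Y z) $ i)"
  by (intro smooth_on_bounded_linear[OF bounded_linear_vec_nth]
      smooth_on_bounded_linear[OF bounded_linear_fst] smooth_on_vfield)

lemma smooth_on_snd_vfield: "is_vfield X U Y \<Longrightarrow> smooth_on W (\<lambda>z. snd (Y z) $ a)"
  by (intro smooth_on_bounded_linear[OF bounded_linear_vec_nth]
      smooth_on_bounded_linear[OF bounded_linear_snd] smooth_on_vfield)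

lemmas smooth_xi = smooth_base_comp[OF smooth_on_fst_vfield]
lemmas smooth_phi = smooth_base_comp[OF smooth_on_snd_vfield]

lemma smooth_charQ: "is_vfield X U Y \<Longrightarrow> smooth_on J (charQ lbl Y a)"
  unfolding charQ_def[abs_def]
  by (intro smooth_on_diff smooth_on_sum smooth_on_mult smooth_xi smooth_phi smooth_crd)

lemma ord_charQ: "ord (Suc 0) (charQ lbl Y a)"
  unfolding charQ_def[abs_def]
  by (intro ord_diff ord_sum ord_mult ord_crd ord_base[of _ "\<lambda>z. fst (Y z) $ _"]
      ord_base[of _ "\<lambda>z. snd (Y z) $ a"]) simp

lemma tderivs_Cons: "tderivs n lbl (j # js) g = tderiv n lbl j (tderivs n lbl js g)"
  and tderivs_Nil: "tderivs n lbl [] g = g"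
  by (simp_all add: tderivs_def)

lemma smooth_tderivs: "smooth_on J g \<Longrightarrow> smooth_on J (tderivs n lbl is g)"
  by (induction "is") (simp_all add: tderivs_Cons tderivs_Nil smooth_tderiv)

lemma ord_tderivs:
  assumes "smooth_on J g" "ord m g"
  shows "length is + m \<le> Suc n \<Longrightarrow> ord (length is + m) (tderivs n lbl is g)"
  by (induction "is") (simp_all add: tderivs_Cons tderivs_Nil assms ord_tderiv smooth_tderivs)

lemma smooth_prol_u:
  assumes "is_vfield X U Y"
  shows "smooth_on J (prol_u n lbl Y a is)"
proof (induction "is")
  case Nil
  show ?case by (simp add: smooth_phi[OF assms])
next
  case (Cons j js)
  then show ?case
    unfolding prol_u.simps
    by (intro smooth_on_diff smooth_on_sum smooth_on_mult smooth_crd smooth_tderiv smooth_xi assms)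
qed

lemma ord_prol_u:
  assumes "is_vfield X U Y"
  shows "length is \<le> n \<Longrightarrow> ord (length is) (prol_u n lbl Y a is)"
proof (induction "is")
  case Nil
  show ?case by (simp add: ord_base[of _ "\<lambda>z. snd (Y z) $ a"])
next
  case (Cons j js)
  have "ord (Suc 0) (tderiv n lbl j (\<lambda>Q. fst (Y (base lbl Q)) $ i))" for i
    using ord_tderiv[OF ord_base[of 0 "\<lambda>z. fst (Y z) $ i"] smooth_xi[OF assms]] by simp
  then have xi: "ord (Suc (length js)) (tderiv n lbl j (\<lambda>Q. fst (Y (base lbl Q)) $ i))" for i
    by (rule ord_mono) simp
  have u: "ord (Suc (length js)) (crd lbl (JU a (mset js + {#i#})))" for i
    by (rule ord_crd) simp
  have prol: "ord (Suc (length js)) (tderiv n lbl j (prol_u n lbl Y a js))"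
    using Cons by (simp add: ord_tderiv smooth_prol_u assms)
  show ?case
    unfolding prol_u.simps by (simp add: ord_diff[OF prol ord_sum[OF ord_mult[OF xi u]]] del: union_mset_add_mset_right)
qed

text \<open>Applying D_j to the formula for K differentiates each product \<xi>^i u_{K+i}; the part
  with D_j \<xi>^i is what the recursion of \<open>prol_u\<close> subtracts, and the rest is the sum
  for K + j. The bound |K| < n keeps every u_{K+i} a coordinate of J^n and, in the step, keeps the
  differentiated ones below order n, where \<open>tderiv\<close> is not truncated.\<close>

lemma tderivs_charQ:
  assumes "is_vfield X U Y"
  shows "length is < n \<Longrightarrow> P \<in> J \<Longrightarrow> tderivs n lbl is (charQ lbl Y a) P =
    prol_u n lbl Y a is P - (\<Sum>i\<in>UNIV. fst (Y (base lbl P)) $ i * crd lbl (JU a (mset is + {#i#})) P)"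
proof (induction "is" arbitrary: P)
  case Nil
  then show ?case by (simp add: tderivs_Nil charQ_def)
next
  case (Cons j js)
  let ?xi = "\<lambda>i P. fst (Y (base lbl P)) $ i"
  let ?u = "\<lambda>i. crd lbl (JU a (mset js + {#i#}))"
  have len: "length js < n" "\<And>i. size (mset js + {#i#}) < n" using Cons.prems(1) by simp_all
  have sm: "smooth_on J (prol_u n lbl Y a js)" "\<And>i. smooth_on J (\<lambda>P. ?xi i P * ?u i P)"
    by (intro smooth_prol_u smooth_on_mult smooth_xi smooth_crd assms)+
  have "tderivs n lbl (j # js) (charQ lbl Y a) P =
      tderiv n lbl j (\<lambda>P. prol_u n lbl Y a js P - (\<Sum>i\<in>UNIV. ?xi i P * ?u i P)) P"
    unfolding tderivs_Cons
    by (rule tderiv_cong[OF _ Cons.prems(2)])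
      (use Cons.IH[OF len(1)] in \<open>auto intro!: smooth_tderivs smooth_charQ assms\<close>)
  also have "\<dots> = tderiv n lbl j (prol_u n lbl Y a js) P - (\<Sum>i\<in>UNIV. tderiv n lbl j (\<lambda>P. ?xi i P * ?u i P) P)"
    using sm Cons.prems(2) by (simp add: tderiv_diff tderiv_sum smooth_on_sum)
  also have "(\<Sum>i\<in>UNIV. tderiv n lbl j (\<lambda>P. ?xi i P * ?u i P) P) =
      (\<Sum>i\<in>UNIV. ?xi i P * crd lbl (JU a (mset (j # js) + {#i#})) P + tderiv n lbl j (?xi i) P * ?u i P)"
  proof (rule sum.cong[OF refl])
    fix i
    show "tderiv n lbl j (\<lambda>P. ?xi i P * ?u i P) P =
        ?xi i P * crd lbl (JU a (mset (j # js) + {#i#})) P + tderiv n lbl j (?xi i) P * ?u i P"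
      using tderiv_mult[OF smooth_xi[OF assms] smooth_crd Cons.prems(2)]
        tderiv_crd_JU[OF len(2) Cons.prems(2)]
      by (simp add: add_mset_commute)
  qed
  finally show ?case by (simp add: sum.distrib)
qed

end

section \<open>The section of the jet space defined by commuting vector fields\<close>

text \<open>The \<open>f i\<close> are the right-hand sides of the first-order system u_i =
  f_i(x,u). As the fields \<open>E i\<close> have constant x-components, \<open>compat\<close> is
  the vanishing of their brackets, the Frobenius condition.\<close>

locale flat_section = jet X U n lbl
  for X :: "(real^'p::{finite,linorder}) set" and U :: "(real^'q::finite) set"
    and n :: nat and lbl :: "'c::finite \<Rightarrow> ('p,'q) jlab" +
  fixes f :: "'p \<Rightarrow> (real^'p::{finite,linorder}) \<times> (real^'q) \<Rightarrow> real^'q"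
  assumes smooth_f: "smooth_on (X \<times> U) (f i)"
    and compat: "z \<in> X \<times> U \<Longrightarrow>
      frechet_derivative (f j) (at z) (axis i 1, f i z) = frechet_derivative (f i) (at z) (axis j 1, f j z)"
begin

definition E :: "'p \<Rightarrow> (real^'p::{finite,linorder}) \<times> (real^'q) \<Rightarrow> (real^'p::{finite,linorder}) \<times> (real^'q)" where
  "E i z = (axis i 1, f i z)"

text \<open>The iterated derivative of u^a along the fields \<open>E i\<close>, the head of the list
  acting last. Lists longer than n matter: \<open>prol_u_sec\<close> uses length n + 1, for which
  J^n has no coordinate.\<close>

primrec Fj :: "'q \<Rightarrow> 'p list \<Rightarrow> (real^'p::{finite,linorder}) \<times> (real^'q) \<Rightarrow> real" where
  "Fj a [] = (\<lambda>z. snd z $ a)"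
| "Fj a (i # is) = (\<lambda>z. frechet_derivative (Fj a is) (at z) (E i z))"

lemma smooth_E: "smooth_on W (E i)"
  unfolding E_def[abs_def] by (intro smooth_on_Pair smooth_on_const smooth_f)

lemma smooth_Fj: "smooth_on W (Fj a is)"
proof (induction "is")
  case Nil
  have "bounded_linear (\<lambda>z :: (real^'p::{finite,linorder}) \<times> (real^'q). snd z $ a)"
    by (intro bounded_linear_compose[OF bounded_linear_vec_nth] bounded_linear_snd)
  then show ?case by (simp add: smooth_on_linear)
next
  case (Cons i "is")
  then show ?case
    by (simp add: smooth_on_frechet_derivative_along open_W smooth_E)
qed

lemma frechet_derivative_E:
  assumes "z \<in> W"
  shows "frechet_derivative (E j) (at z) v = (0, frechet_derivative (f j) (at z) v)"
proof -
  have "(E j has_derivative (\<lambda>v. (0, frechet_derivative (f j) (at z) v))) (at z)"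
    unfolding E_def[abs_def]
    by (intro has_derivative_Pair has_derivative_const smooth_on_has_derivative[OF smooth_f assms])
  from fun_cong[OF frechet_derivative_at[OF this], of v] show ?thesis by simp
qed

text \<open>By \<open>frechet_derivative_along\<close> the two sides differ by the derivative of g
  along the bracket of \<open>E i\<close> and \<open>E j\<close>, which vanishes by
  \<open>compat\<close>, and by the antisymmetric part of the second derivative, which is
  zero.\<close>

lemma E_commute:
  fixes g :: "(real^'p::{finite,linorder}) \<times> (real^'q::finite) \<Rightarrow> real"
  assumes "smooth_on W g" "z \<in> W"
  shows "frechet_derivative (\<lambda>y. frechet_derivative g (at y) (E j y)) (at z) (E i z) =
    frechet_derivative (\<lambda>y. frechet_derivative g (at y) (E i y)) (at z) (E j z)"
proof -
  have "frechet_derivative (E j) (at z) (E i z) = frechet_derivative (E i) (at z) (E j z)"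
    using compat[OF assms(2)] by (simp add: frechet_derivative_E[OF assms(2)] E_def)
  then show ?thesis
    unfolding frechet_derivative_along[OF open_W assms(2,1) smooth_E]
    using frechet_derivative_commute[OF assms(1) open_W assms(2)] by simp
qed

lemma Fj_Cons_cong:
  assumes "\<And>y. y \<in> W \<Longrightarrow> Fj a is y = Fj a js y" "z \<in> W"
  shows "Fj a (i # is) z = Fj a (i # js) z"
  using frechet_derivative_cong_open[OF open_W assms(2) smooth_Fj assms(1)] by simp

text \<open>The letter j passes the letters in front of it one at a time by
  \<open>E_commute\<close>.\<close>

lemma Fj_move:
  "j \<in> set is \<Longrightarrow> z \<in> W \<Longrightarrow> Fj a is z = Fj a (j # remove1 j is) z"
proof (induction "is" arbitrary: z)
  case (Cons k ks)
  show ?case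
  proof (cases "k = j")
    case False
    then have "Fj a (k # ks) z = Fj a (k # j # remove1 j ks) z"
      using Cons by (intro Fj_Cons_cong) auto
    also have "\<dots> = Fj a (j # k # remove1 j ks) z"
      using E_commute[OF smooth_Fj Cons.prems(2)] by simp
    finally show ?thesis using False by simp
  qed simp
qed simp

lemma Fj_perm: "mset is = mset js \<Longrightarrow> z \<in> W \<Longrightarrow> Fj a is z = Fj a js z"
proof (induction "is" arbitrary: js z)
  case (Cons i "is")
  have i: "i \<in> set js" using Cons.prems(1) by (metis list.set_intros(1) set_mset_mset)
  have "mset is = mset (remove1 i js)" using Cons.prems(1)[symmetric] by simp
  then have "Fj a (i # is) z = Fj a (i # remove1 i js) z"
    using Cons.IH Cons.prems(2) by (intro Fj_Cons_cong) auto
  then show ?case using Fj_move[OF i Cons.prems(2)] by simp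
qed simp

text \<open>Sorting merely selects one list for each multiset; by \<open>Fj_perm\<close> the
  selection is immaterial over X x U.\<close>

definition sec :: "(real^'p::{finite,linorder}) \<times> (real^'q) \<Rightarrow> real^'c" where
  "sec z = (\<chi> c. case lbl c of JX k \<Rightarrow> fst z $ k | JU a K \<Rightarrow> Fj a (sorted_list_of_multiset K) z)"

lemma crd_sec:
  "crd lbl (JX k) (sec z) = fst z $ k"
  "size K \<le> n \<Longrightarrow> crd lbl (JU a K) (sec z) = Fj a (sorted_list_of_multiset K) z"
  unfolding sec_def crd_def by (simp_all add: lbl_inv)

lemma length_sorted_list_of_multiset: "length (sorted_list_of_multiset K) = size K"
  by (metis mset_sorted_list_of_multiset size_mset)

lemma crd_sec_mset:
  "length is \<le> n \<Longrightarrow> z \<in> W \<Longrightarrow> crd lbl (JU a (mset is)) (sec z) = Fj a is z"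
  by (simp add: crd_sec) (intro Fj_perm, simp_all)

lemma base_sec [simp]: "base lbl (sec z) = z"
  by (simp add: base_def xpt_def upt_def crd_sec prod_eq_iff vec_eq_iff)

lemma sec_in_J: "z \<in> W \<Longrightarrow> sec z \<in> J"
  by (simp add: J_iff)

lemma has_derivative_sec:
  assumes "z \<in> W"
  shows "(sec has_derivative (\<lambda>v. \<chi> c. case lbl c of JX k \<Rightarrow> fst v $ k
     | JU a K \<Rightarrow> frechet_derivative (Fj a (sorted_list_of_multiset K)) (at z) v)) (at z)"
    (is "(_ has_derivative ?D) _")
proof -
  have comp: "((\<lambda>y. sec y $ c) has_derivative (\<lambda>v. ?D v $ c)) (at z)" for c
  proof (cases "lbl c")
    case (JX k)
    have "bounded_linear (\<lambda>v :: (real^'p::{finite,linorder}) \<times> (real^'q). fst v $ k)"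
      by (intro bounded_linear_compose[OF bounded_linear_vec_nth] bounded_linear_fst)
    then show ?thesis by (simp add: sec_def JX bounded_linear_imp_has_derivative)
  next
    case (JU a K)
    then show ?thesis by (simp add: sec_def smooth_on_has_derivative[OF smooth_Fj assms])
  qed
  have expand: "v = (\<Sum>c\<in>UNIV. v $ c *\<^sub>R axis c 1)" for v :: "real^'c"
    using basis_expansion[of v] by (simp add: scalar_mult_eq_scaleR)
  have "((\<lambda>y. \<Sum>c\<in>UNIV. sec y $ c *\<^sub>R axis c (1::real)) has_derivative
      (\<lambda>v. \<Sum>c\<in>UNIV. ?D v $ c *\<^sub>R axis c 1)) (at z)"
    by (intro has_derivative_sum has_derivative_scaleR_left comp)
  then show ?thesis unfolding expand[symmetric] .
qed

text \<open>The differential of \<open>sec\<close> maps \<open>E i z\<close> to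
  \<open>tvec i (sec z)\<close> up to components of order n, where \<open>tvec\<close> was cut off;
  a function of order m < n does not see these.\<close>

lemma tderiv_sec:
  assumes "smooth_on J g" "ord m g" "m < n" "z \<in> W"
  shows "tderiv n lbl i g (sec z) = frechet_derivative (\<lambda>y. g (sec y)) (at z) (E i z)"
proof -
  let ?D = "\<lambda>v. \<chi> c. case lbl c of JX k \<Rightarrow> fst v $ k
     | JU a K \<Rightarrow> frechet_derivative (Fj a (sorted_list_of_multiset K)) (at z) v"
  have J: "sec z \<in> J" using assms(4) sec_in_J by blast
  have crd_D: "crd lbl (JX k) (?D v) = fst v $ k"
    "size K \<le> n \<Longrightarrow> crd lbl (JU a K) (?D v) = frechet_derivative (Fj a (sorted_list_of_multiset K)) (at z) v"
    for k a K v
    by (simp_all add: crd_def lbl_inv)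
  \<comment> \<open>Both sides are the value of u_{K+i} on the section: on the left as E_i E_K u, on
    the right as the shifted coordinate.\<close>
  have "crd lbl (JU a K) (?D (E i z)) = crd lbl (JU a K) (tvec i (sec z))" if "size K \<le> m" for a K
    using that assms(3) crd_sec_mset[of "i # sorted_list_of_multiset K" z a] assms(4)
    by (simp add: crd_D crd_tvec length_sorted_list_of_multiset)
  moreover have "crd lbl (JX k) (?D (E i z)) = crd lbl (JX k) (tvec i (sec z))" for k
    by (simp add: crd_D crd_tvec E_def axis_def)
  ultimately have "agree lbl m (?D (E i z) - tvec i (sec z)) 0"
    by (simp add: agree_def crd_diff crd_0)
  from frechet_derivative_vertical[OF assms(2,1) J this]
  have "frechet_derivative g (at (sec z)) (?D (E i z)) = frechet_derivative g (at (sec z)) (tvec i (sec z))"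
    using linear_diff[OF linear_frechet_smooth_on[OF assms(1) J]] by simp
  moreover have "((\<lambda>y. g (sec y)) has_derivative (\<lambda>v. frechet_derivative g (at (sec z)) (?D v))) (at z)"
    using has_derivative_compose[OF has_derivative_sec[OF assms(4)] smooth_on_has_derivative[OF assms(1) J]] .
  from fun_cong[OF frechet_derivative_at[OF this], of "E i z"]
  have "frechet_derivative g (at (sec z)) (?D (E i z)) = frechet_derivative (\<lambda>y. g (sec y)) (at z) (E i z)" .
  ultimately show ?thesis by (simp add: tderiv_eq[OF assms(1) J])
qed

text \<open>For |K| < n this is the characteristic equation read through
  \<open>tderivs_charQ\<close>. For |K| = n no such equation is available on J^n, so the formula for
  one index fewer is differentiated along \<open>E j\<close>, which is why it is required on all of
  X x U. The derivatives of the \<xi>^i cancel against the correction in \<open>prol_u\<close>, and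
  commuting E_j with E_i gives the stated form.\<close>

lemma prol_u_sec:
  assumes Z: "is_vfield X U Z"
    and char: "\<And>y is. y \<in> W \<Longrightarrow> length is < n \<Longrightarrow> tderivs n lbl is (charQ lbl Z a) (sec y) = 0"
    and len: "length is \<le> n" and z: "z \<in> W"
  shows "prol_u n lbl Z a is (sec z) = (\<Sum>i\<in>UNIV. fst (Z z) $ i * Fj a (i # is) z)"
proof -
  have low: "prol_u n lbl Z a js (sec y) = (\<Sum>i\<in>UNIV. fst (Z y) $ i * Fj a (i # js) y)"
    if "length js < n" "y \<in> W" for js y
    using tderivs_charQ[OF Z that(1) sec_in_J[OF that(2)], of a] char[OF that(2,1)] that
      crd_sec_mset[of "_ # js" y a]
    by simp
  show ?thesis
  proof (cases "is")
    case Nil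
    then show ?thesis using low[of "[]" z] z n_pos by simp
  next
    case (Cons j js)
    let ?xi = "\<lambda>i z. fst (Z z) $ i"
    have lj: "length js < n" using len Cons by simp
    have "tderiv n lbl j (prol_u n lbl Z a js) (sec z) =
        frechet_derivative (\<lambda>y. prol_u n lbl Z a js (sec y)) (at z) (E j z)"
      using tderiv_sec[OF smooth_prol_u[OF Z] ord_prol_u[OF Z] lj z] lj by simp
    also have "frechet_derivative (\<lambda>y. prol_u n lbl Z a js (sec y)) (at z) =
        frechet_derivative (\<lambda>y. \<Sum>i\<in>UNIV. ?xi i y * Fj a (i # js) y) (at z)"
      by (rule frechet_derivative_cong_open[OF open_W z, symmetric])
        (use low[OF lj] in \<open>auto intro!: smooth_on_sum smooth_on_mult smooth_on_fst_vfield[OF Z] smooth_Fj simp del: Fj.simps\<close>)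
    also have "\<dots> = (\<lambda>v. \<Sum>i\<in>UNIV. ?xi i z * frechet_derivative (Fj a (i # js)) (at z) v
        + frechet_derivative (?xi i) (at z) v * Fj a (i # js) z)"
      by (rule frechet_derivative_at[symmetric])
        (intro has_derivative_sum has_derivative_mult
          smooth_on_has_derivative[OF _ z] smooth_on_fst_vfield[OF Z] smooth_Fj)
    finally have 1: "tderiv n lbl j (prol_u n lbl Z a js) (sec z) =
        (\<Sum>i\<in>UNIV. ?xi i z * Fj a (j # i # js) z
          + frechet_derivative (?xi i) (at z) (E j z) * Fj a (i # js) z)"
      by simp
    have 2: "tderiv n lbl j (\<lambda>Q. ?xi i (base lbl Q)) (sec z) = frechet_derivative (?xi i) (at z) (E j z)" for i
      using tderiv_sec[OF smooth_xi[OF Z] ord_base[of 0 "?xi i"] _ z] n_pos by simp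
    have 3: "crd lbl (JU a (mset js + {#i#})) (sec z) = Fj a (i # js) z" for i
      using crd_sec_mset[of "i # js" z a] lj z by simp
    have "prol_u n lbl Z a (j # js) (sec z) = (\<Sum>i\<in>UNIV. ?xi i z * Fj a (j # i # js) z)"
      unfolding prol_u.simps 1 2 3 by (simp add: sum.distrib)
    moreover have "Fj a (j # i # js) z = Fj a (i # j # js) z" for i
      by (intro Fj_perm z) (simp add: add_mset_commute)
    ultimately show ?thesis unfolding Cons by simp
  qed
qed

text \<open>The formula of \<open>prol_u_sec\<close> involves the field only through its x-component
  at z.\<close>

lemma prolong_sec_cong:
  assumes "is_vfield X U Z" "is_vfield X U Y" "z \<in> W" "fst (Z z) = fst (Y z)"
    and "\<And>y a is. y \<in> W \<Longrightarrow> length is < n \<Longrightarrow> tderivs n lbl is (charQ lbl Z a) (sec y) = 0"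
    and "\<And>y a is. y \<in> W \<Longrightarrow> length is < n \<Longrightarrow> tderivs n lbl is (charQ lbl Y a) (sec y) = 0"
  shows "prolong n lbl Z (sec z) = prolong n lbl Y (sec z)"
proof -
  have "prol_u n lbl Z a (sorted_list_of_multiset K) (sec z) = prol_u n lbl Y a (sorted_list_of_multiset K) (sec z)"
    if "size K \<le> n" for a K
  proof -
    have "length (sorted_list_of_multiset K) \<le> n"
      using that by (simp add: length_sorted_list_of_multiset)
    from prol_u_sec[OF assms(1,5) this assms(3)] prol_u_sec[OF assms(2,6) this assms(3)] assms(4)
    show ?thesis by simp
  qed
  moreover have "size K \<le> n" if "lbl c = JU a K" for c a K
    using lbl_in[of c] that by simp
  ultimately show ?thesis
    using assms(4) by (auto simp: prolong_def vec_eq_iff split: jlab.split)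
qed

end


section \<open>The characteristic system of a rectified algebra\<close>

lemma subspace_values:
  assumes "vf_subspace L"
  shows "subspace ((\<lambda>Z. fst (Z z)) ` L)"
  unfolding subspace_def
proof (intro conjI ballI allI)
  note L = assms[unfolded vf_subspace_def]
  show "0 \<in> (\<lambda>Z. fst (Z z)) ` L"
    by (rule image_eqI[of _ _ "\<lambda>z. 0"]) (use L in auto)
  fix x assume "x \<in> (\<lambda>Z. fst (Z z)) ` L"
  then obtain Z where Z: "Z \<in> L" "x = fst (Z z)" by blast
  show "c *\<^sub>R x \<in> (\<lambda>Z. fst (Z z)) ` L" for c
    by (rule image_eqI[of _ _ "\<lambda>z. c *\<^sub>R Z z"]) (use L Z in auto)
  fix y assume "y \<in> (\<lambda>Z. fst (Z z)) ` L"
  then obtain Z' where Z': "Z' \<in> L" "y = fst (Z' z)" by blast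
  show "x + y \<in> (\<lambda>Z. fst (Z z)) ` L"
    by (rule image_eqI[of _ _ "\<lambda>z. Z z + Z' z"]) (use L Z Z' in auto)
qed

text \<open>The form in which the algebra \<open>L'\<close> enters the geometry:
  \<open>snd_eq\<close> says that each characteristic is the combination of the f_i - u_i with
  coefficients \<xi>^i, and \<open>transitive\<close> that these coefficients are arbitrary at a
  given point.\<close>

locale characteristic_section = flat_section X U n lbl f
  for X :: "(real^'p::{finite,linorder}) set" and U :: "(real^'q::finite) set"
    and n :: nat and lbl :: "'c::finite \<Rightarrow> ('p,'q) jlab"
    and f :: "'p \<Rightarrow> (real^'p::{finite,linorder}) \<times> (real^'q::finite) \<Rightarrow> real^'q" +
  fixes L' :: "('p,'q) vfield set"
  assumes vfield: "Y \<in> L' \<Longrightarrow> is_vfield X U Y"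
    and snd_eq: "Y \<in> L' \<Longrightarrow> z \<in> X \<times> U \<Longrightarrow> snd (Y z) = (\<Sum>i\<in>UNIV. fst (Y z) $ i *\<^sub>R f i z)"
    and transitive: "z \<in> X \<times> U \<Longrightarrow> \<exists>Y\<in>L'. fst (Y z) = v"
begin

abbreviation "C \<equiv> char_system n lbl X U"

lemma char_systemD:
  "P \<in> C L \<Longrightarrow> Z \<in> L \<Longrightarrow> length is < n \<Longrightarrow> tderivs n lbl is (charQ lbl Z a) P = 0"
  using n_pos by (auto simp: char_system_def)

lemma char_system_in_J: "P \<in> C L \<Longrightarrow> P \<in> J"
  by (simp add: char_system_def)

text \<open>On the section u_i = f_i, so the characteristics vanish; their total derivatives are
  then derivatives along the \<open>E j\<close> of functions that vanish identically on X x
  U.\<close>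

lemma tderivs_charQ_sec:
  assumes "Y \<in> L'"
  shows "z \<in> W \<Longrightarrow> length is < n \<Longrightarrow> tderivs n lbl is (charQ lbl Y a) (sec z) = 0"
proof (induction "is" arbitrary: z)
  case Nil
  have "frechet_derivative (\<lambda>z. snd z $ a) (at z) = (\<lambda>v. snd v $ a)"
  proof (rule frechet_derivative_at[symmetric])
    have "bounded_linear (\<lambda>v :: (real^'p::{finite,linorder}) \<times> (real^'q::finite). snd v $ a)"
      by (rule bounded_linear_compose[OF bounded_linear_vec_nth bounded_linear_snd])
    then show "((\<lambda>z :: (real^'p::{finite,linorder}) \<times> (real^'q::finite). snd z $ a)
        has_derivative (\<lambda>v. snd v $ a)) (at z)"
      by (rule bounded_linear_imp_has_derivative)
  qed
  then have "crd lbl (JU a {#i#}) (sec z) = f i z $ a" for i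
    using crd_sec_mset[of "[i]" z a] n_pos Nil.prems(1) by (simp add: E_def)
  then show ?case
    by (simp add: tderivs_Nil charQ_def snd_eq[OF assms Nil.prems(1)])
next
  case (Cons j js)
  have "smooth_on J (tderivs n lbl js (charQ lbl Y a))"
    by (intro smooth_tderivs smooth_charQ vfield assms)
  \<comment> \<open>A characteristic has order one, so this order is the length of
    \<open>j # js\<close>, which is below n as \<open>tderiv_sec\<close> demands.\<close>
  moreover have "ord (length js + Suc 0) (tderivs n lbl js (charQ lbl Y a))"
    by (rule ord_tderivs[OF smooth_charQ[OF vfield[OF assms]] ord_charQ]) (use Cons.prems in simp)
  ultimately have "tderivs n lbl (j # js) (charQ lbl Y a) (sec z) =
      frechet_derivative (\<lambda>y. tderivs n lbl js (charQ lbl Y a) (sec y)) (at z) (E j z)"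
    unfolding tderivs_Cons by (rule tderiv_sec) (use Cons.prems in simp_all)
  also have "frechet_derivative (\<lambda>y. tderivs n lbl js (charQ lbl Y a) (sec y)) (at z) =
      frechet_derivative (\<lambda>y. 0) (at z)"
    by (rule frechet_derivative_cong_open[OF open_W Cons.prems(1) smooth_on_const, symmetric])
      (use Cons.IH Cons.prems(2) in simp)
  finally show ?case by simp
qed

lemma sec_in_char_system: "z \<in> W \<Longrightarrow> sec z \<in> C L'"
  unfolding char_system_def using tderivs_charQ_sec sec_in_J n_pos by auto

text \<open>Coordinates are determined order by order: for a field with x-component e_i at the base
  point, D_K Q = 0 reads u_{K+i} = \<phi>_K, and \<phi>_K depends only on coordinates of order at
  most |K|.\<close>

lemma char_system_unique:
  assumes P: "P \<in> C L'"
  shows "P = sec (base lbl P)"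
proof -
  let ?z = "base lbl P"
  have J: "P \<in> J" "?z \<in> W" "sec ?z \<in> J"
    using char_system_in_J[OF P] by (simp_all add: J_iff)
  have agr: "m \<le> n \<Longrightarrow> agree lbl m P (sec ?z)" for m
  proof (induction m)
    case 0
    have "crd lbl (JX i) P = fst ?z $ i" "crd lbl (JU a {#}) P = snd ?z $ a" for i a
      by (simp_all add: base_def xpt_def upt_def)
    then show ?case by (simp add: agree_def crd_sec)
  next
    case (Suc m)
    then have IH: "agree lbl m P (sec ?z)" by simp
    have "crd lbl (JU a K) P = crd lbl (JU a K) (sec ?z)" if K: "size K = Suc m" for a K
    proof -
      obtain i K' where K': "K = add_mset i K'" using K by (metis size_eq_Suc_imp_eq_union)
      let ?is = "sorted_list_of_multiset K'"
      have len: "length ?is = m" "length ?is < n"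
        using K K' Suc.prems by (simp_all add: length_sorted_list_of_multiset)
      obtain Y where Y: "Y \<in> L'" "fst (Y ?z) = axis i 1" using transitive[OF J(2)] by blast
      have "prol_u n lbl Y a ?is P = prol_u n lbl Y a ?is (sec ?z)"
        by (rule ordD[OF ord_prol_u[OF vfield[OF Y(1)]] J(1,3)]) (use len IH in simp_all)
      moreover have "tderivs n lbl ?is (charQ lbl Y a) P = 0"
        by (rule char_systemD[OF P Y(1) len(2)])
      moreover have "tderivs n lbl ?is (charQ lbl Y a) (sec ?z) = 0"
        by (rule tderivs_charQ_sec[OF Y(1) J(2) len(2)])
      ultimately show ?thesis
        unfolding tderivs_charQ[OF vfield[OF Y(1)] len(2) J(1)] tderivs_charQ[OF vfield[OF Y(1)] len(2) J(3)]
        by (simp add: Y(2) K' axis_def if_distrib[of "\<lambda>x. x * _"] cong: if_cong)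
    qed
    then show ?case using IH by (auto simp: agree_def le_Suc_eq)
  qed
  have "P $ c = sec ?z $ c" for c
  proof -
    have "crd lbl (lbl c) P = crd lbl (lbl c) (sec ?z)"
      using agr[of n] lbl_in[of c] by (auto simp: agree_def jlabs_def)
    then show ?thesis by (simp add: crd_def)
  qed
  then show ?thesis by (simp add: vec_eq_iff)
qed

text \<open>The section lies in the common system, so the characteristic equations of Z hold along
  all of it, as do those of Y, and \<open>prolong_sec_cong\<close> applies.\<close>

lemma prolong_eq_if_fst_eq:
  assumes "\<And>Z. Z \<in> L \<Longrightarrow> is_vfield X U Z" "C L = C L'"
    and "P \<in> C L'" "Z \<in> L" "Y \<in> L'" "fst (Z (base lbl P)) = fst (Y (base lbl P))"
  shows "prolong n lbl Z P = prolong n lbl Y P"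
proof -
  have z: "base lbl P \<in> W" using char_system_in_J[OF assms(3)] by (simp add: J_iff)
  have "prolong n lbl Z (sec (base lbl P)) = prolong n lbl Y (sec (base lbl P))"
  proof (rule prolong_sec_cong[OF assms(1)[OF assms(4)] vfield[OF assms(5)] z assms(6)])
    fix y a and "is" :: "'p list" assume *: "y \<in> W" "length is < n"
    show "tderivs n lbl is (charQ lbl Z a) (sec y) = 0"
      by (rule char_systemD[OF _ assms(4) *(2)]) (simp add: assms(2) sec_in_char_system *)
    show "tderivs n lbl is (charQ lbl Y a) (sec y) = 0"
      by (rule tderivs_charQ_sec[OF assms(5) *])
  qed
  then show ?thesis using char_system_unique[OF assms(3)] by simp
qed

text \<open>If \<open>v \<noteq> 0\<close> annihilated all \<open>x\<close>-components of \<open>L\<close> at a point of the characteristic system,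
  adding the symbol \<open>v\<^sup>K\<close> to the top-order coordinates would produce a second point of the
  characteristic system over the same base point.\<close>
lemma transitive_if_same_char_system:
  assumes L: "\<And>Z. Z \<in> L \<Longrightarrow> is_vfield X U Z" "vf_subspace L" "C L = C L'" and P: "P \<in> C L'"
  shows "\<exists>Z\<in>L. fst (Z (base lbl P)) = w"
proof -
  let ?z = "base lbl P"
  let ?S = "(\<lambda>Z. fst (Z ?z)) ` L"
  have J: "P \<in> J" using char_system_in_J[OF P] .
  have span: "span ?S = ?S" using subspace_values[OF L(2)] by (simp add: span_eq_iff)
  have "span ?S = UNIV"
  proof (rule ccontr)
    assume "span ?S \<noteq> UNIV"
    then obtain v where v: "v \<noteq> 0" and "\<forall>x\<in>span ?S. v \<bullet> x = 0"
      using span_not_UNIV_orthogonal by blast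
    then have orth: "(\<Sum>i\<in>UNIV. fst (Z ?z) $ i * v $ i) = 0" if "Z \<in> L" for Z
      using that by (simp add: span inner_vec_def mult.commute)
    \<comment> \<open>Any fixed dependent variable will do; perturbing one of them is enough for a
      second point.\<close>
    define a0 :: 'q where "a0 = undefined"
    define D :: "real^'c" where "D = (\<chi> c. case lbl c of JX k \<Rightarrow> 0
      | JU a K \<Rightarrow> if a = a0 \<and> size K = n then prod_mset (image_mset (($) v) K) else 0)"
    have crd_D: "crd lbl (JX k) D = 0" "size K \<le> n \<Longrightarrow> crd lbl (JU a K) D =
      (if a = a0 \<and> size K = n then prod_mset (image_mset (($) v) K) else 0)" for k a K
      by (simp_all add: D_def crd_def lbl_inv)
    have agr: "agree lbl (n - 1) P (P + D)"
      using n_pos by (auto simp: agree_def crd_add crd_D)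
    have J': "P + D \<in> J" using agree_in_J[OF agr J] .
    have base: "base lbl (P + D) = ?z" using agree_base[OF agr] by simp
    have "tderivs n lbl is (charQ lbl Z a) (P + D) = 0" if Z: "Z \<in> L" and len: "length is < n" for Z a "is"
    proof -
      \<comment> \<open>The perturbation D lives in order n only, while \<phi>_K has order |K| <
        n.\<close>
      have "prol_u n lbl Z a is P = prol_u n lbl Z a is (P + D)"
        by (rule ordD[OF ord_prol_u[OF L(1)[OF Z]] J J'])
          (use len agree_mono[OF agr] in simp_all)
      moreover have "tderivs n lbl is (charQ lbl Z a) P = 0"
        using char_systemD[OF _ Z len] P L(3) by simp
      \<comment> \<open>At top order the symbol is multiplicative, v^{K+i} = v^K v_i, so the sum is
        v^K times the inner product of v with the x-component of Z, which is zero.\<close>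
      moreover have "(\<Sum>i\<in>UNIV. fst (Z ?z) $ i * crd lbl (JU a (mset is + {#i#})) D) = 0"
      proof (cases "a = a0 \<and> Suc (length is) = n")
        case True
        then have "(\<Sum>i\<in>UNIV. fst (Z ?z) $ i * crd lbl (JU a (mset is + {#i#})) D)
          = (\<Sum>i\<in>UNIV. prod_mset (image_mset (($) v) (mset is)) * (fst (Z ?z) $ i * v $ i))"
          using len by (intro sum.cong) (simp_all add: crd_D)
        then show ?thesis by (simp add: orth[OF Z] flip: sum_distrib_left)
      next
        case False
        then show ?thesis using len by (intro sum.neutral) (auto simp: crd_D)
      qed
      ultimately show ?thesis
        unfolding tderivs_charQ[OF L(1)[OF Z] len J] tderivs_charQ[OF L(1)[OF Z] len J'] base
        by (simp add: crd_add distrib_left sum.distrib)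
    qed
    then have "P + D \<in> C L" using J' n_pos by (auto simp: char_system_def)
    then have "P + D = sec ?z" using char_system_unique[of "P + D"] L(3) base by simp
    then have "D = 0" using char_system_unique[OF P] by simp
    \<comment> \<open>For K consisting of n copies of i the symbol is the n-th power of v_i, so D =
      0 forces v = 0.\<close>
    then have "crd lbl (JU a0 (replicate_mset n i)) D = 0" for i by (simp add: crd_0)
    then have "v $ i = 0" for i by (simp add: crd_D)
    with v show False by (simp add: vec_eq_iff)
  qed
  then have "w \<in> ?S" using span by simp
  then show ?thesis by auto
qed

text \<open>Tangency only concerns the value of a prolongation at each point, and at each point of
  the common system the two algebras prolong to the same vectors. The partner of a field may change
  from point to point.\<close>

lemma conditional_symmetries_iff:
  assumes "vf_lie_algebra X U L" "vf_lie_algebra X U L'" "C L = C L'"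
  shows "conditional_symmetries n lbl X U S L \<longleftrightarrow> conditional_symmetries n lbl X U S L'"
proof -
  have L: "\<And>Z. Z \<in> L \<Longrightarrow> is_vfield X U Z" "vf_subspace L"
    using assms(1) by (simp_all add: vf_lie_algebra_def)
  have eq: "\<exists>Y\<in>L'. prolong n lbl Z P = prolong n lbl Y P" if P: "P \<in> C L'" and Z: "Z \<in> L" for P Z
  proof -
    have "base lbl P \<in> W" using char_system_in_J[OF P] by (simp add: J_iff)
    from transitive[OF this, of "fst (Z (base lbl P))"] obtain Y
      where Y: "Y \<in> L'" "fst (Y (base lbl P)) = fst (Z (base lbl P))" by (rule bexE)
    from prolong_eq_if_fst_eq[OF L(1) assms(3) P Z Y(1) Y(2)[symmetric]] show ?thesis
      using Y(1) by (rule bexI)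
  qed
  have eq': "\<exists>Z\<in>L. prolong n lbl Y P = prolong n lbl Z P" if P: "P \<in> C L'" and Y: "Y \<in> L'" for P Y
  proof -
    from transitive_if_same_char_system[OF L assms(3) P, of "fst (Y (base lbl P))"] obtain Z
      where Z: "Z \<in> L" "fst (Z (base lbl P)) = fst (Y (base lbl P))" by (rule bexE)
    from prolong_eq_if_fst_eq[OF L(1) assms(3) P Z(1) Y Z(2)] show ?thesis
      using Z(1) by (intro bexI[of _ Z]) simp_all
  qed
  have "(\<forall>Z\<in>L. \<forall>P\<in>S \<inter> C L'. prolong n lbl Z P \<in> tangent_set (S \<inter> C L') P) \<longleftrightarrow>
    (\<forall>Y\<in>L'. \<forall>P\<in>S \<inter> C L'. prolong n lbl Y P \<in> tangent_set (S \<inter> C L') P)"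
  proof (intro iffI ballI)
    fix Y P
    assume *: "\<forall>Z\<in>L. \<forall>P\<in>S \<inter> C L'. prolong n lbl Z P \<in> tangent_set (S \<inter> C L') P"
      and Y: "Y \<in> L'" and P: "P \<in> S \<inter> C L'"
    from eq'[OF IntD2[OF P] Y] obtain Z where "Z \<in> L" "prolong n lbl Y P = prolong n lbl Z P" by (rule bexE)
    then show "prolong n lbl Y P \<in> tangent_set (S \<inter> C L') P" using * P by simp
  next
    fix Z P
    assume *: "\<forall>Y\<in>L'. \<forall>P\<in>S \<inter> C L'. prolong n lbl Y P \<in> tangent_set (S \<inter> C L') P"
      and Z: "Z \<in> L" and P: "P \<in> S \<inter> C L'"
    from eq[OF IntD2[OF P] Z] obtain Y where "Y \<in> L'" "prolong n lbl Z P = prolong n lbl Y P" by (rule bexE)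
    then show "prolong n lbl Z P \<in> tangent_set (S \<inter> C L') P" using * P by simp
  qed
  then show ?thesis
    by (simp only: conditional_symmetries_def tangent_to_def assms)
qed

end

section \<open>Solving the characteristic equations of a rectified algebra\<close>

lemma smooth_on_det:
  fixes M :: "'a::euclidean_space \<Rightarrow> real^'n^'n"
  assumes "\<And>i j. smooth_on S (\<lambda>z. M z $ i $ j)"
  shows "smooth_on S (\<lambda>z. det (M z))"
  unfolding det_def
  by (rule smooth_on_sum[OF smooth_on_mult[OF smooth_on_const smooth_on_prod[OF assms]]])

text \<open>The x-components at a point already form a subspace, so spanning means that every vector
  is attained by a single field.\<close>

lemma rectified_transitive:
  assumes "rectified_pde_lie_algebra X U L" "z \<in> X \<times> U"
  shows "\<exists>Y\<in>L. fst (Y z) = v"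
proof -
  let ?S = "(\<lambda>Y. fst (Y z)) ` L"
  have sub: "vf_subspace L" and UNIV: "span ?S = UNIV"
    using assms by (auto simp: rectified_pde_lie_algebra_def vf_lie_algebra_def)
  have "span ?S = ?S" using subspace_values[OF sub] by (simp add: span_eq_iff)
  then have "v \<in> ?S" using UNIV by simp
  then show ?thesis by auto
qed

text \<open>For a basis of the algebra, the equations Q = 0 form a square linear system for the u_i
  with invertible matrix of x-components. Cramer's rule expresses the solution rationally in smooth
  entries, and the relation extends from the basis by linearity.\<close>

lemma rectified_solved_form:
  fixes X :: "(real^'p::finite) set" and U :: "(real^'q::finite) set"
  assumes "rectified_pde_lie_algebra X U L"
  shows "\<exists>f :: 'p \<Rightarrow> (real^'p::finite) \<times> (real^'q::finite) \<Rightarrow> real^'q.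
    (\<forall>i. smooth_on (X \<times> U) (f i)) \<and>
    (\<forall>Y\<in>L. \<forall>z\<in>X \<times> U. snd (Y z) = (\<Sum>i\<in>UNIV. fst (Y z) $ i *\<^sub>R f i z))"
proof -
  obtain B where B: "finite B" "B \<subseteq> L" "vf_spans B L" "card B = CARD('p)"
    using assms by (auto simp: rectified_pde_lie_algebra_def vf_dim_eq_def)
  \<comment> \<open>The dimension equals the number of independent variables; indexing the basis by
    \<open>'p\<close> makes the matrix A below square.\<close>
  obtain b :: "'p \<Rightarrow> _" where b: "bij_betw b UNIV B"
    using finite_same_card_bij[OF finite_class.finite_UNIV B(1)] B(4) by metis
  have bL: "b k \<in> L" for k using b B(2) by (auto simp: bij_betw_def)
  then have vf: "is_vfield X U (b k)" for k
    using assms by (simp add: rectified_pde_lie_algebra_def vf_lie_algebra_def)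
  have comb: "\<exists>c. \<forall>z. Y z = (\<Sum>k\<in>UNIV. c k *\<^sub>R b k z)" if "Y \<in> L" for Y
  proof -
    obtain c where "Y = (\<lambda>z. \<Sum>\<beta>\<in>B. c \<beta> *\<^sub>R \<beta> z)" using B(3) \<open>Y \<in> L\<close> unfolding vf_spans_def by blast
    then have "Y z = (\<Sum>k\<in>UNIV. c (b k) *\<^sub>R b k z)" for z
      using sum.reindex_bij_betw[OF b, of "\<lambda>\<beta>. c \<beta> *\<^sub>R \<beta> z"] by simp
    then show ?thesis by (intro exI[of _ "\<lambda>k. c (b k)"]) simp
  qed
  define A where "A z = (\<chi> k i. fst (b k z) $ i)" for z
  define r where "r a z = (\<chi> k. snd (b k z) $ a)" for a z
  define f where "f i z = (\<chi> a. det (\<chi> k j. if j = i then r a z $ k else A z $ k $ j) / det (A z))" for i z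
  have smA: "smooth_on (X \<times> U) (\<lambda>z. A z $ k $ i)" for k i
    unfolding A_def vec_lambda_beta using vf[of k, unfolded is_vfield_def]
    by (intro smooth_on_bounded_linear[OF bounded_linear_compose[OF bounded_linear_vec_nth bounded_linear_fst]]) simp
  have smr: "smooth_on (X \<times> U) (\<lambda>z. r a z $ k)" for a k
    unfolding r_def vec_lambda_beta using vf[of k, unfolded is_vfield_def]
    by (intro smooth_on_bounded_linear[OF bounded_linear_compose[OF bounded_linear_vec_nth bounded_linear_snd]]) simp
  have det: "det (A z) \<noteq> 0" if z: "z \<in> X \<times> U" for z
  proof -
    \<comment> \<open>The rows are the x-components of the basis fields at z; a field with
      x-component v at z is a combination of the basis.\<close>
    have "v \<in> span (rows (A z))" for v
    proof -
      obtain Y where Y: "Y \<in> L" "fst (Y z) = v" using rectified_transitive[OF assms z] by blast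
      obtain c where c: "Y z = (\<Sum>k\<in>UNIV. c k *\<^sub>R b k z)" using comb[OF Y(1)] by blast
      have "v = (\<Sum>k\<in>UNIV. c k *\<^sub>R fst (b k z))"
        unfolding Y(2)[symmetric] c by (simp add: fst_sum)
      moreover have "fst (b k z) \<in> rows (A z)" for k
        unfolding rows_def row_def A_def by (auto simp: vec_eq_iff)
      ultimately show ?thesis by (simp add: span_sum span_scale span_base)
    qed
    then have "span (rows (A z)) = UNIV" by blast
    then have "\<exists>M. M ** A z = mat 1" by (simp add: matrix_left_invertible_span_rows)
    then show ?thesis using invertible_left_inverse invertible_det_nz by blast
  qed
  have "smooth_on (X \<times> U) (\<lambda>z. f i z $ a)" for i a
  proof -
    have "smooth_on (X \<times> U) (\<lambda>z. (\<chi> k j. if j = i then r a z $ k else A z $ k $ j) $ k $ j)" for k j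
      by (cases "j = i") (simp_all add: smA smr)
    from smooth_on_divide[OF smooth_on_det[OF this] smooth_on_det[OF smA] det]
    show ?thesis by (simp add: f_def)
  qed
  then have "smooth_on (X \<times> U) (f i)" for i by (rule smooth_on_vec)
  moreover have "snd (Y z) = (\<Sum>i\<in>UNIV. fst (Y z) $ i *\<^sub>R f i z)" if "Y \<in> L" "z \<in> X \<times> U" for Y z
  proof -
    have "A z *v (\<chi> i. f i z $ a) = r a z" for a
      using cramer[OF det[OF that(2)]] by (simp add: f_def)
    then have "(\<Sum>i\<in>UNIV. fst (b k z) $ i * f i z $ a) = snd (b k z) $ a" for k a
      by (auto simp: vec_eq_iff matrix_vector_mult_def A_def r_def)
    then have bk: "snd (b k z) = (\<Sum>i\<in>UNIV. fst (b k z) $ i *\<^sub>R f i z)" for k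
      by (simp add: vec_eq_iff)
    obtain c where c: "Y z = (\<Sum>k\<in>UNIV. c k *\<^sub>R b k z)" using comb[OF \<open>Y \<in> L\<close>] by blast
    have "snd (Y z) = (\<Sum>k\<in>UNIV. \<Sum>i\<in>UNIV. c k *\<^sub>R fst (b k z) $ i *\<^sub>R f i z)"
      unfolding c snd_sum snd_scaleR bk scaleR_sum_right by simp
    also have "\<dots> = (\<Sum>i\<in>UNIV. \<Sum>k\<in>UNIV. (c k * fst (b k z) $ i) *\<^sub>R f i z)"
      by (subst sum.swap) simp
    also have "\<dots> = (\<Sum>i\<in>UNIV. fst (Y z) $ i *\<^sub>R f i z)"
      unfolding c fst_sum by (simp add: scaleR_sum_left)
    finally show ?thesis .
  qed
  ultimately show ?thesis by blast
qed

text \<open>The field \<open>E i\<close> itself need not lie in L, but some Y in L takes the same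
  value at z. Differentiating the solved form of Y at z gives the derivative of \<open>f i\<close>
  plus terms in the derivative of the x-components; for two such fields with vanishing bracket the
  latter terms coincide.\<close>

lemma rectified_compatibility:
  fixes X :: "(real^'p::finite) set" and U :: "(real^'q::finite) set"
    and f :: "'p \<Rightarrow> (real^'p::finite) \<times> (real^'q::finite) \<Rightarrow> real^'q"
  assumes rect: "rectified_pde_lie_algebra X U L" and op: "open (X \<times> U)"
    and f: "\<And>i. smooth_on (X \<times> U) (f i)"
    and snd_eq: "\<And>Y z. Y \<in> L \<Longrightarrow> z \<in> X \<times> U \<Longrightarrow> snd (Y z) = (\<Sum>i\<in>UNIV. fst (Y z) $ i *\<^sub>R f i z)"
    and z: "z \<in> X \<times> U"
  shows "frechet_derivative (f j) (at z) (axis i 1, f i z) = frechet_derivative (f i) (at z) (axis j 1, f j z)"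
proof -
  have field: "\<exists>Y\<in>L. Y z = (axis i 1, f i z) \<and>
    (\<forall>v. snd (frechet_derivative Y (at z) v) =
      (\<Sum>l\<in>UNIV. fst (frechet_derivative Y (at z) v) $ l *\<^sub>R f l z) + frechet_derivative (f i) (at z) v)" for i
  proof -
    obtain Y where Y: "Y \<in> L" "fst (Y z) = axis i 1" using rectified_transitive[OF rect z] by blast
    have delta: "(\<Sum>l\<in>UNIV. axis i (1::real) $ l *\<^sub>R h l) = h i" for h :: "'p \<Rightarrow> real^'q"
      by (simp add: axis_def if_distrib[of "\<lambda>x. x *\<^sub>R _"] cong: if_cong)
    have Yz: "Y z = (axis i 1, f i z)"
      using Y snd_eq[OF Y(1) z] delta[of "\<lambda>l. f l z"] by (simp add: prod_eq_iff)
    let ?Y = "frechet_derivative Y (at z)"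
    have "smooth_on (X \<times> U) Y"
      using rect Y(1) by (simp add: rectified_pde_lie_algebra_def vf_lie_algebra_def is_vfield_def)
    then have dY: "(Y has_derivative ?Y) (at z)" using z by (rule smooth_on_has_derivative)
    have comp: "((\<lambda>y. fst (Y y) $ l) has_derivative (\<lambda>v. fst (?Y v) $ l)) (at z)" for l
      by (rule bounded_linear.has_derivative[OF bounded_linear_vec_nth has_derivative_fst[OF dY]])
    have "((\<lambda>y. \<Sum>l\<in>UNIV. fst (Y y) $ l *\<^sub>R f l y) has_derivative
        (\<lambda>v. \<Sum>l\<in>UNIV. fst (Y z) $ l *\<^sub>R frechet_derivative (f l) (at z) v + fst (?Y v) $ l *\<^sub>R f l z)) (at z)"
      by (rule has_derivative_sum[OF has_derivative_scaleR[OF comp smooth_on_has_derivative[OF f z]]])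
    then have "((\<lambda>y. snd (Y y)) has_derivative
        (\<lambda>v. \<Sum>l\<in>UNIV. fst (Y z) $ l *\<^sub>R frechet_derivative (f l) (at z) v + fst (?Y v) $ l *\<^sub>R f l z)) (at z)"
      by (rule has_derivative_transform_within_open[OF _ op z]) (simp add: snd_eq[OF Y(1)])
    from has_derivative_unique[OF has_derivative_snd[OF dY] this]
    have "snd (?Y v) = (\<Sum>l\<in>UNIV. axis i 1 $ l *\<^sub>R frechet_derivative (f l) (at z) v + fst (?Y v) $ l *\<^sub>R f l z)" for v
      unfolding Y(2) by meson
    then show ?thesis using Y(1) Yz by (auto simp: sum.distrib delta)
  qed
  obtain Yi where Yi: "Yi \<in> L" "Yi z = (axis i 1, f i z)"
    "\<And>v. snd (frechet_derivative Yi (at z) v) =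
      (\<Sum>l\<in>UNIV. fst (frechet_derivative Yi (at z) v) $ l *\<^sub>R f l z) + frechet_derivative (f i) (at z) v"
    using field[of i] by blast
  obtain Yj where Yj: "Yj \<in> L" "Yj z = (axis j 1, f j z)"
    "\<And>v. snd (frechet_derivative Yj (at z) v) =
      (\<Sum>l\<in>UNIV. fst (frechet_derivative Yj (at z) v) $ l *\<^sub>R f l z) + frechet_derivative (f j) (at z) v"
    using field[of j] by blast
  have "vf_bracket X U Yi Yj z = 0"
    using rect[unfolded rectified_pde_lie_algebra_def] Yi(1) Yj(1) z by blast
  \<comment> \<open>Equality of the full derivatives includes their x-components, so the sums over l
    in the two solved forms cancel and only the derivatives of \<open>f j\<close> and
    \<open>f i\<close> remain.\<close>
  then have "frechet_derivative Yj (at z) (Yi z) = frechet_derivative Yi (at z) (Yj z)"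
    using z by (simp add: vf_bracket_def)
  then show ?thesis
    using Yi(3)[of "Yj z"] Yj(3)[of "Yi z"] by (simp add: Yi(2) Yj(2))
qed

theorem mainTheorem16:
  fixes X :: "(real^'p::{finite,linorder}) set" and U :: "(real^'q::finite) set"
    and n :: nat and lbl :: "'c::finite \<Rightarrow> ('p,'q) jlab"
    and s :: nat and \<Delta> :: "nat \<Rightarrow> real^'c \<Rightarrow> real"
    and L L' :: "('p,'q) vfield set"
  assumes "open X" and "open U" and "n \<ge> 1"
    and "bij_betw lbl UNIV (jlabs n)"
    and "maximal_rank_system lbl X U s \<Delta>"
    and "vf_lie_algebra X U L"
    and "rectified_pde_lie_algebra X U L'"
    and "char_system n lbl X U L = char_system n lbl X U L'"
    and "nonvacuously_transversal (char_system n lbl X U L) (pde_system lbl X U s \<Delta>)"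
  shows "conditional_symmetries n lbl X U (pde_system lbl X U s \<Delta>) L
     \<longleftrightarrow> conditional_symmetries n lbl X U (pde_system lbl X U s \<Delta>) L'"
proof -
  obtain f :: "'p \<Rightarrow> (real^'p::{finite,linorder}) \<times> (real^'q::finite) \<Rightarrow> real^'q"
    where f: "\<And>i. smooth_on (X \<times> U) (f i)"
      "\<And>Y z. Y \<in> L' \<Longrightarrow> z \<in> X \<times> U \<Longrightarrow> snd (Y z) = (\<Sum>i\<in>UNIV. fst (Y z) $ i *\<^sub>R f i z)"
    using rectified_solved_form[OF assms(7)] by blast
  have alg: "vf_lie_algebra X U L'" using assms(7) by (simp add: rectified_pde_lie_algebra_def)
  interpret characteristic_section X U n lbl f L'
  proof unfold_locales
    show "frechet_derivative (f j) (at z) (axis i 1, f i z) = frechet_derivative (f i) (at z) (axis j 1, f j z)"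
      if "z \<in> X \<times> U" for z i j
      by (rule rectified_compatibility[OF assms(7) open_Times[OF assms(1,2)] _ _ that]) (fact f)+
    show "is_vfield X U Y" if "Y \<in> L'" for Y
      using alg that by (simp add: vf_lie_algebra_def)
    show "\<exists>Y\<in>L'. fst (Y z) = v" if "z \<in> X \<times> U" for z v
      using rectified_transitive[OF assms(7) that] .
  qed (use assms f in auto)
  show ?thesis by (rule conditional_symmetries_iff[OF assms(6) alg assms(8)])
qed

end
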